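(* Let $G$ be a finite abelian group of cardinality $n\geq3$. The tensors $T_G$ and $CW_n$ have the same sweet pieces: for every probability distribution $P$ on the six blocks in the support of $CW_n$ that is reconstructable from its three marginals and whose three marginals are the same distribution, and for every positive integer $N$ such that $N\cdot P$ is integral, the tensors $SP_{P,N}(T_G)$ and $SP_{P,N}(CW_n)$ are isomorphic. In particular, $SP_{P,N}(CW_n)$ has rank at most $n^N$.
   Context: $\mathbb{K}$ is an algebraically closed field of characteristic zero. For a finite abelian group $G$ (identified with a basis of $\mathbb{K}^G$), $T_G=\sum_{g_1+g_2=g_3}g_1\otimes g_2\otimes g_3\in\mathbb{K}^G\otimes\mathbb{K}^G\otimes\mathbb{K}^G$. The Coppersmith–Winograd tensor is $$CW_n=\sum_{i=1}^ne_1\otimes e_i\otimes e_i+\sum_{i=2}^ne_i\otimes e_1\otimes e_i+\sum_{i=2}^{n-1}e_i\otimes e_i\otimes e_n\in(\mathbb{K}^n)^{\otimes3}.$$ Blockings. For $CW_n$: in the first two factors $e_1\mapsto-2$, $e_2,\ldots,e_{n-1}\mapsto1$, $e_n\mapsto4$; in the third factor $e_n\mapsto-2$, $e_2,\ldots,e_{n-1}\mapsto1$, $e_1\mapsto4$. The six blocks in the support are indexed by the permutations of $(-2,1,1)$ and of $(-2,-2,4)$. For $T_G$: fix an element $g\in G$ different from the neutral element $0$; in the first two factors $0\mapsto-2$, $g\mapsto4$, all other elements $\mapsto1$; in the third factor $g\mapsto-2$, $0\mapsto4$, all other elements $\mapsto1$. A probability distribution $P$ on the support has three marginals $P_1,P_2,P_3$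 on the labels $\{-2,1,4\}$; it is reconstructable from its marginals if it is the only probability distribution on the six blocks with these marginals. Let $T\in V_1\otimes V_2\otimes V_3$ be one of the two tensors $CW_n$ (with $V_i=\mathbb{K}^n$ and basis $e_1,\ldots,e_n$) or $T_G$ (with $V_i=\mathbb{K}^G$ and basis $G$), where the label of a basis vector of $V_i$ is the integer in $\{-2,1,4\}$ assigned to it in the $i$-th factor by the blocking of $CW_n$, respectively of $T_G$ (that is, for $i=1,2$ the vector $e_1$, respectively $0$, has label $-2$, the vector $e_n$, respectively $g$, has label $4$, and all others have label $1$; for $i=3$ the labels $-2$ and $4$ are interchanged). Then $SP_{P,N}(T)$ is the image of the Kronecker power $T^{\boxtimes N}$ under the coordinate projection keeping, in the factor $V_i^{\otimes N}$, exactly the basis vectors $b_1\otimes\cdots\otimes b_N$ in whose sequence of labels every label $a$ occurs exactly $N\cdot P_i(a)$ times. Two tensors are isomorphic if they agree after linear isomorphisms of the three factors. Rank is the usual tensor rank. *)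

theory Defs
  imports
    "HOL-Computational_Algebra.Computational_Algebra"
    "HOL-Algebra.Coset"
    "HOL-Probability.Probability_Mass_Function"
begin

text \<open>
  A tensor in \<open>K\<^sup>I \<otimes> K\<^sup>J \<otimes> K\<^sup>L\<close> is given by its index sets
  \<open>I = idx1\<close>, \<open>J = idx2\<close>, \<open>L = idx3\<close> and its coordinates in the standard basis. Only the values
  of \<open>coord\<close> at arguments from the index sets are meaningful, and everything below depends on
  these values only. All index sets are meant to be finite.
\<close>

record ('a, 'k) tensor =
  idx1 :: "'a set"
  idx2 :: "'a set"
  idx3 :: "'a set"
  coord :: "'a \<Rightarrow> 'a \<Rightarrow> 'a \<Rightarrow> 'k"

definition unit_vec :: "'a \<Rightarrow> 'a \<Rightarrow> 'k::field" where
  "unit_vec i = (\<lambda>a. if a = i then 1 else 0)"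

definition pure_tensor ::
    "('a \<Rightarrow> 'k::field) \<Rightarrow> ('b \<Rightarrow> 'k) \<Rightarrow> ('c \<Rightarrow> 'k) \<Rightarrow> 'a \<Rightarrow> 'b \<Rightarrow> 'c \<Rightarrow> 'k" where
  "pure_tensor u v w = (\<lambda>a b c. u a * v b * w c)"

definition tensor_rank :: "('a, 'k::field) tensor \<Rightarrow> nat" where
  "tensor_rank T = (LEAST r. \<exists>u v w :: nat \<Rightarrow> 'a \<Rightarrow> 'k.
     \<forall>a\<in>idx1 T. \<forall>b\<in>idx2 T. \<forall>c\<in>idx3 T.
       coord T a b c = (\<Sum>s<r. pure_tensor (u s) (v s) (w s) a b c))"

definition coord_space :: "'a set \<Rightarrow> ('a \<Rightarrow> 'k::field) set" where
  "coord_space I = {v. \<forall>a. a \<notin> I \<longrightarrow> v a = 0}"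

definition linear_iso ::
    "'a set \<Rightarrow> 'b set \<Rightarrow> (('a \<Rightarrow> 'k::field) \<Rightarrow> ('b \<Rightarrow> 'k)) \<Rightarrow> bool" where
  "linear_iso I J f \<longleftrightarrow>
     bij_betw f (coord_space I) (coord_space J) \<and>
     (\<forall>u\<in>coord_space I. \<forall>v\<in>coord_space I. f (\<lambda>a. u a + v a) = (\<lambda>b. f u b + f v b)) \<and>
     (\<forall>c. \<forall>v\<in>coord_space I. f (\<lambda>a. c * v a) = (\<lambda>b. c * f v b))"

text \<open>The coordinates of \<open>(f \<otimes> g \<otimes> h) T\<close>.\<close>

definition tensor_map ::
    "(('a \<Rightarrow> 'k::field) \<Rightarrow> ('b \<Rightarrow> 'k)) \<Rightarrow> (('a \<Rightarrow> 'k) \<Rightarrow> ('b \<Rightarrow> 'k)) \<Rightarrow>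
     (('a \<Rightarrow> 'k) \<Rightarrow> ('b \<Rightarrow> 'k)) \<Rightarrow> ('a, 'k) tensor \<Rightarrow> 'b \<Rightarrow> 'b \<Rightarrow> 'b \<Rightarrow> 'k" where
  "tensor_map f g h T = (\<lambda>a' b' c'. \<Sum>a\<in>idx1 T. \<Sum>b\<in>idx2 T. \<Sum>c\<in>idx3 T.
     coord T a b c * pure_tensor (f (unit_vec a)) (g (unit_vec b)) (h (unit_vec c)) a' b' c')"

definition tensor_iso :: "('a, 'k::field) tensor \<Rightarrow> ('b, 'k) tensor \<Rightarrow> bool" where
  "tensor_iso T S \<longleftrightarrow> (\<exists>f g h.
     linear_iso (idx1 T) (idx1 S) f \<and> linear_iso (idx2 T) (idx2 S) g \<and>
     linear_iso (idx3 T) (idx3 S) h \<and>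
     (\<forall>a\<in>idx1 S. \<forall>b\<in>idx2 S. \<forall>c\<in>idx3 S. tensor_map f g h T a b c = coord S a b c))"

text \<open>
  The standard basis of \<open>(K\<^sup>I)\<^sup>\<otimes>\<^sup>N\<close> is indexed by the words of length \<open>N\<close> over \<open>I\<close>.
\<close>

definition kronecker_power :: "('a, 'k::field) tensor \<Rightarrow> nat \<Rightarrow> ('a list, 'k) tensor" where
  "kronecker_power T N =
     \<lparr>idx1 = {xs. set xs \<subseteq> idx1 T \<and> length xs = N},
      idx2 = {xs. set xs \<subseteq> idx2 T \<and> length xs = N},
      idx3 = {xs. set xs \<subseteq> idx3 T \<and> length xs = N},
      coord = (\<lambda>xs ys zs. \<Prod>i<N. coord T (xs ! i) (ys ! i) (zs ! i))\<rparr>"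

text \<open>
  The coordinate projection onto the coordinate subspaces spanned by the basis vectors indexed
  by \<open>A\<close>, \<open>B\<close>, \<open>C\<close>; the remaining coordinates are discarded by shrinking the index sets.
\<close>

definition coord_projection ::
    "'a set \<Rightarrow> 'a set \<Rightarrow> 'a set \<Rightarrow> ('a, 'k) tensor \<Rightarrow> ('a, 'k) tensor" where
  "coord_projection A B C T =
     T\<lparr>idx1 := idx1 T \<inter> A, idx2 := idx2 T \<inter> B, idx3 := idx3 T \<inter> C\<rparr>"

definition label :: "'a \<Rightarrow> 'a \<Rightarrow> 'a \<Rightarrow> int" where
  "label lo hi x = (if x = lo then -2 else if x = hi then 4 else 1)"

text \<open>
  The blockings used are \<open>label lo hi\<close> in the first two factors and \<open>label hi lo\<close> in the third,
  with \<open>(lo, hi) = (1, n)\<close> for \<open>CW_tensor n\<close> and \<open>(lo, hi) = (\<one>\<^bsub>G\<^esub>, g)\<close> for \<open>group_tensor G\<close>.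
\<close>

definition support_blocks :: "'a \<Rightarrow> 'a \<Rightarrow> ('a, 'k::field) tensor \<Rightarrow> (int \<times> int \<times> int) set" where
  "support_blocks lo hi T =
     {(label lo hi a, label lo hi b, label hi lo c) | a b c.
        a \<in> idx1 T \<and> b \<in> idx2 T \<and> c \<in> idx3 T \<and> coord T a b c \<noteq> 0}"

definition marginal1 :: "(int \<times> int \<times> int) pmf \<Rightarrow> int pmf" where
  "marginal1 P = map_pmf (\<lambda>(a, b, c). a) P"

definition marginal2 :: "(int \<times> int \<times> int) pmf \<Rightarrow> int pmf" where
  "marginal2 P = map_pmf (\<lambda>(a, b, c). b) P"

definition marginal3 :: "(int \<times> int \<times> int) pmf \<Rightarrow> int pmf" where
  "marginal3 P = map_pmf (\<lambda>(a, b, c). c) P"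

definition reconstructable ::
    "(int \<times> int \<times> int) set \<Rightarrow> (int \<times> int \<times> int) pmf \<Rightarrow> bool" where
  "reconstructable B P \<longleftrightarrow>
     (\<forall>Q. set_pmf Q \<subseteq> B \<and> marginal1 Q = marginal1 P \<and> marginal2 Q = marginal2 P \<and>
          marginal3 Q = marginal3 P \<longrightarrow> Q = P)"

definition words_of_type :: "('a \<Rightarrow> int) \<Rightarrow> nat \<Rightarrow> int pmf \<Rightarrow> 'a list set" where
  "words_of_type l N p = {xs. \<forall>a. real (count_list (map l xs) a) = real N * pmf p a}"

definition sweet_piece ::
    "'a \<Rightarrow> 'a \<Rightarrow> (int \<times> int \<times> int) pmf \<Rightarrow> nat \<Rightarrow> ('a, 'k::field) tensor \<Rightarrow> ('a list, 'k) tensor" where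
  "sweet_piece lo hi P N T =
     coord_projection
       (words_of_type (label lo hi) N (marginal1 P))
       (words_of_type (label lo hi) N (marginal2 P))
       (words_of_type (label hi lo) N (marginal3 P))
       (kronecker_power T N)"

definition CW_tensor :: "nat \<Rightarrow> (nat, 'k::field) tensor" where
  "CW_tensor n =
     \<lparr>idx1 = {1..n}, idx2 = {1..n}, idx3 = {1..n},
      coord = (\<lambda>a b c.
        (\<Sum>i = 1..n. pure_tensor (unit_vec 1) (unit_vec i) (unit_vec i) a b c) +
        (\<Sum>i = 2..n. pure_tensor (unit_vec i) (unit_vec 1) (unit_vec i) a b c) +
        (\<Sum>i = 2..n - 1. pure_tensor (unit_vec i) (unit_vec i) (unit_vec n) a b c))\<rparr>"

text \<open>Groups are written multiplicatively as in the algebra library.\<close>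

definition group_tensor :: "('g, 'm) monoid_scheme \<Rightarrow> ('g, 'k::field) tensor" where
  "group_tensor G =
     \<lparr>idx1 = carrier G, idx2 = carrier G, idx3 = carrier G,
      coord = (\<lambda>a b c.
        \<Sum>(g1, g2, g3) \<in> {(g1, g2, g3). g1 \<in> carrier G \<and> g2 \<in> carrier G \<and> g3 \<in> carrier G \<and>
                                  g1 \<otimes>\<^bsub>G\<^esub> g2 = g3}.
          pure_tensor (unit_vec g1) (unit_vec g2) (unit_vec g3) a b c)\<rparr>"

lemma CW_tensor_coord:
  assumes "a \<in> {1..n}" "b \<in> {1..n}" "c \<in> {1..n}"
  shows "coord (CW_tensor n :: (nat, 'k::field) tensor) a b c =
    (if a = 1 \<and> b = c then 1 else 0) + (if 2 \<le> a \<and> b = 1 \<and> a = c then 1 else 0) +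
    (if 2 \<le> a \<and> a \<le> n - 1 \<and> b = a \<and> c = n then 1 else 0)"
proof -
  have *: "(\<Sum>i\<in>A. pure_tensor (unit_vec 1) (unit_vec i) (unit_vec i) a b c) =
      (if a = 1 \<and> b = c \<and> b \<in> A then 1 else (0::'k))" if "finite A" for A :: "nat set"
  proof -
    have "(\<Sum>i\<in>A. pure_tensor (unit_vec 1) (unit_vec i) (unit_vec i) a b c) =
        (\<Sum>i\<in>A. if i = b then (if a = 1 \<and> b = c then 1 else (0::'k)) else 0)"
      by (rule sum.cong) (auto simp: pure_tensor_def unit_vec_def)
    then show ?thesis using that by (simp add: sum.delta')
  qed
  have **: "(\<Sum>i\<in>A. pure_tensor (unit_vec i) (unit_vec 1) (unit_vec i) a b c) =
      (if b = 1 \<and> a = c \<and> a \<in> A then 1 else (0::'k))" if "finite A" for A :: "nat set"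
  proof -
    have "(\<Sum>i\<in>A. pure_tensor (unit_vec i) (unit_vec 1) (unit_vec i) a b c) =
        (\<Sum>i\<in>A. if i = a then (if b = 1 \<and> a = c then 1 else (0::'k)) else 0)"
      by (rule sum.cong) (auto simp: pure_tensor_def unit_vec_def)
    then show ?thesis using that by (simp add: sum.delta')
  qed
  have ***: "(\<Sum>i\<in>A. pure_tensor (unit_vec i) (unit_vec i) (unit_vec n) a b c) =
      (if a = b \<and> c = n \<and> a \<in> A then 1 else (0::'k))" if "finite A" for A :: "nat set"
  proof -
    have "(\<Sum>i\<in>A. pure_tensor (unit_vec i) (unit_vec i) (unit_vec n) a b c) =
        (\<Sum>i\<in>A. if i = a then (if a = b \<and> c = n then 1 else (0::'k)) else 0)"
      by (rule sum.cong) (auto simp: pure_tensor_def unit_vec_def)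
    then show ?thesis using that by (simp add: sum.delta')
  qed
  show ?thesis
    unfolding CW_tensor_def tensor.simps
    by (subst *, simp, subst **, simp, subst ***, simp) (use assms in auto)
qed

lemma support_blocks_CW_tensor:
  assumes "n \<ge> 3"
  shows "support_blocks 1 n (CW_tensor n :: (nat, 'k::field) tensor) =
    {(-2, 1, 1), (1, -2, 1), (1, 1, -2), (-2, -2, 4), (-2, 4, -2), (4, -2, -2)}"
proof -
  define S :: "(nat \<times> nat \<times> nat) set" where
    "S = {(a, b, c). a \<in> {1..n} \<and> b \<in> {1..n} \<and> c \<in> {1..n} \<and>
       (a = 1 \<and> b = c \<or> a \<ge> 2 \<and> b = 1 \<and> a = c \<or> 2 \<le> a \<and> a \<le> n - 1 \<and> b = a \<and> c = n)}"
  let ?L = "\<lambda>(a, b, c). (label 1 n a, label 1 n b, label n 1 c)"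
  have "support_blocks 1 n (CW_tensor n :: (nat, 'k) tensor) = ?L ` S"
  proof -
    have coord: "coord (CW_tensor n :: (nat, 'k) tensor) a b c \<noteq> 0 \<longleftrightarrow> (a, b, c) \<in> S"
      if "a \<in> {1..n}" "b \<in> {1..n}" "c \<in> {1..n}" for a b c
    proof -
      have "a = 1 \<Longrightarrow> \<not> 2 \<le> a" by simp
      moreover have "2 \<le> a \<Longrightarrow> b = 1 \<Longrightarrow> a \<noteq> b" by simp
      ultimately show ?thesis
        unfolding CW_tensor_coord[OF that] S_def mem_Collect_eq prod.case using that
        by (smt (verit) add_0 add_0_right zero_neq_one)
    qed
    have "(a \<in> idx1 (CW_tensor n :: (nat, 'k) tensor) \<and> b \<in> idx2 (CW_tensor n :: (nat, 'k) tensor) \<and>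
           c \<in> idx3 (CW_tensor n :: (nat, 'k) tensor) \<and>
           coord (CW_tensor n :: (nat, 'k) tensor) a b c \<noteq> 0) \<longleftrightarrow> (a, b, c) \<in> S" for a b c
    proof -
      have "idx1 (CW_tensor n :: (nat, 'k) tensor) = {1..n}" "idx2 (CW_tensor n :: (nat, 'k) tensor) = {1..n}"
           "idx3 (CW_tensor n :: (nat, 'k) tensor) = {1..n}"
        by (simp_all add: CW_tensor_def)
      moreover have "(a, b, c) \<in> S \<Longrightarrow> a \<in> {1..n} \<and> b \<in> {1..n} \<and> c \<in> {1..n}"
        unfolding S_def mem_Collect_eq prod.case by blast
      ultimately show ?thesis using coord by metis
    qed
    then have "support_blocks 1 n (CW_tensor n :: (nat, 'k) tensor) =
        {(label 1 n a, label 1 n b, label n 1 c) | a b c. (a, b, c) \<in> S}"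
      unfolding support_blocks_def by presburger
    moreover have "{F a b c | a b c. (a, b, c) \<in> X} = (\<lambda>(a, b, c). F a b c) ` X"
      for F :: "nat \<Rightarrow> nat \<Rightarrow> nat \<Rightarrow> int \<times> int \<times> int" and X
      by (auto simp: image_iff) force
    ultimately show ?thesis by metis
  qed
  also have "\<dots> = {(-2, 1, 1), (1, -2, 1), (1, 1, -2), (-2, -2, 4), (-2, 4, -2), (4, -2, -2)}"
    (is "_ = ?B")
  proof
    have lo: "label 1 n 1 = -2" "label n 1 1 = 4"
      and hi: "label 1 n n = 4" "label n 1 n = -2"
      using assms by (simp_all add: label_def)
    have mid: "label 1 n i = 1" "label n 1 i = 1" if "i \<noteq> 1" "i \<noteq> n" for i
      using that by (simp_all add: label_def)
    show "?L ` S \<subseteq> ?B"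
    proof (rule image_subsetI)
      fix x assume "x \<in> S"
      then obtain a b c where x: "x = (a, b, c)" and S: "(a, b, c) \<in> S"
        by (cases x) blast
      from S consider "a = 1" "b = c" | "a \<noteq> 1" "b = 1" "a = c" | "a \<noteq> 1" "a \<noteq> n" "b = a" "c = n"
        unfolding S_def using assms by fastforce
      then show "?L x \<in> ?B"
      proof cases
        case 1
        then show ?thesis
          unfolding x prod.case using lo hi mid[of c] by (cases "c = 1"; cases "c = n"; simp)
      next
        case 2
        then show ?thesis
          unfolding x prod.case using lo hi mid[of c] by (cases "c = n"; simp)
      next
        case 3
        then show ?thesis
          unfolding x prod.case using lo hi mid[of a] by simp
      qed
    qed
    have "2 \<noteq> (1::nat)" "2 \<noteq> n" using assms by simp_all
    note mid2 = mid[OF this]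
    have "(1, 2, 2) \<in> S" "(2, 1, 2) \<in> S" "(2, 2, n) \<in> S" "(1, 1, 1) \<in> S" "(1, n, n) \<in> S"
      "(n, 1, n) \<in> S"
      using assms by (simp_all add: S_def)
    from this[THEN imageI, where f = ?L] show "?B \<subseteq> ?L ` S"
      unfolding prod.case lo hi mid2 by (intro insert_subsetI empty_subsetI)
  qed
  finally show ?thesis .
qed

end

theory Submission
  imports Defs "HOL-Algebra.Multiplicative_Group"
begin

text \<open>
  On every block in the support of \<open>CW\<^sub>n\<close> the three labels sum to \<open>0\<close>, and a block in the support
  of \<open>T\<^sub>G\<close> has a nonnegative label sum. The words kept in a sweet piece have total label sum \<open>0\<close>, so
  only the blocks with label sum \<open>0\<close> contribute. There \<open>T\<^sub>G\<close> differs from \<open>CW\<^sub>n\<close> only by the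
  pairing \<open>a \<mapsto> g - a\<close> in place of the identity on the middle block \<open>(1, 1, -2)\<close>. This symmetric
  bilinear form is diagonalised by a label preserving matrix, whose Kronecker powers map one sweet
  piece to the other. The rank bound is inherited from \<open>T\<^sub>G\<close>, which the characters of \<open>G\<close> write as
  a sum of \<open>n\<close> pure tensors.
\<close>

section \<open>Characters of finite abelian groups\<close>

text \<open>\<open>X ^ m - 1\<close> splits over an algebraically closed field. In characteristic
  zero its derivative \<open>m * X ^ (m - 1)\<close> has no root in common with it, so all
  \<open>m\<close> roots are simple.\<close>

lemma card_roots_of_unity:
  assumes "m > 0"
  shows "card {u :: 'k :: {alg_closed_field, field_char_0}. u ^ m = 1} = m"
proof -
  define p :: "'k poly" where "p = Polynomial.monom 1 m - 1"
  have poly_p: "poly p x = x ^ m - 1" for x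
    by (simp add: p_def poly_monom)
  have "degree (-1 + Polynomial.monom 1 m :: 'k poly) = m"
    using assms by (subst degree_add_eq_right) (simp_all add: degree_monom_eq)
  then have deg: "degree p = m" by (simp add: p_def)
  then have "p \<noteq> 0" using assms by auto
  have "pderiv p = Polynomial.monom (of_nat m) (m - 1)"
    by (simp add: p_def pderiv_diff pderiv_monom)
  then have "rsquarefree p"
    using assms by (auto simp: rsquarefree_roots poly_p poly_monom power_0_left)
  obtain A where A: "size A = degree p" "p = Polynomial.smult (lead_coeff p) (\<Prod>x\<in>#A. [:-x, 1:])"
    using alg_closed_imp_factorization[OF \<open>p \<noteq> 0\<close>] by blast
  have "proots (\<Prod>x\<in>#A. [:-x, 1:]) = A"
  proof (induction A)
    case (add x A)
    have "(\<Prod>x\<in>#A. [:-x, 1:]) \<noteq> 0" by auto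
    then have "proots ([:-x, 1:] * (\<Prod>x\<in>#A. [:-x, 1:])) = add_mset x A"
      by (subst proots_mult) (simp_all add: add.IH)
    then show ?case by simp
  qed simp
  then have "proots p = A"
    using \<open>p \<noteq> 0\<close> by (subst A(2)) simp
  then have "size (proots p) = m" using A(1) deg by simp
  \<comment> \<open>The multiset of roots counts multiplicities; squarefreeness makes every order 1,
    so its size is the number of distinct roots.\<close>
  moreover have "size (proots p) = (\<Sum>x\<in>{x. poly p x = 0}. Polynomial.order x p)"
    using \<open>p \<noteq> 0\<close> by (simp add: size_multiset_overloaded_eq)
  moreover have "\<dots> = card {x. poly p x = 0}"
    using \<open>rsquarefree p\<close> \<open>p \<noteq> 0\<close> by (simp add: rsquarefree_root_order)
  ultimately show ?thesis by (simp add: poly_p)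
qed

text \<open>Multiplication by any root of unity permutes the index set, so a nonzero power sum would
  make all \<open>m\<close> roots of unity solutions of \<open>u ^ i = 1\<close>.\<close>

lemma sum_roots_of_unity_powers:
  assumes "0 < i" "i < m"
  shows "(\<Sum>u | u ^ m = 1. u ^ i) = (0 :: 'k :: {alg_closed_field, field_char_0})"
proof (rule ccontr)
  let ?U = "\<lambda>m. {u :: 'k. u ^ m = 1}"
  let ?S = "\<Sum>u\<in>?U m. u ^ i"
  assume S: "?S \<noteq> 0"
  have "v ^ i = 1" if v: "v ^ m = 1" for v :: 'k
  proof -
    have "v \<noteq> 0" using v assms by (auto simp: power_0_left)
    then have "bij_betw ((*) v) (?U m) (?U m)"
      by (intro bij_betw_byWitness[where f' = "\<lambda>u. u / v"])
         (auto simp: v power_mult_distrib power_divide)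
    then have "?S = (\<Sum>u\<in>?U m. (v * u) ^ i)"
      by (rule sum.reindex_bij_betw[symmetric])
    also have "\<dots> = v ^ i * ?S"
      by (simp add: power_mult_distrib sum_distrib_left)
    finally show ?thesis using S by simp
  qed
  then have "?U m \<subseteq> ?U i" by blast
  moreover have "finite (?U i)"
    using card_roots_of_unity[OF \<open>0 < i\<close>, where ?'k = 'k] \<open>0 < i\<close> card.infinite by fastforce
  ultimately have "card (?U m) \<le> card (?U i)" by (simp add: card_mono)
  then show False using assms card_roots_of_unity[where ?'k = 'k] by simp
qed

text \<open>The roots of order \<open>m\<close> of \<open>c\<close> are one of them,
  \<open>y\<close>, times the \<open>m\<close>-th roots of unity, so their power sums are
  \<open>y ^ i\<close> times vanishing ones.\<close>

lemma obtain_roots: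
  fixes c :: "'k :: {alg_closed_field, field_char_0}"
  assumes "m > 0" "c \<noteq> 0"
  obtains z :: "nat \<Rightarrow> 'k" where "\<And>l. l < m \<Longrightarrow> z l ^ m = c"
    and "\<And>i. 0 < i \<Longrightarrow> i < m \<Longrightarrow> (\<Sum>l<m. z l ^ i) = 0"
proof -
  obtain y where y: "y ^ m = c" using nth_root_exists[OF assms(1)] by blast
  let ?U = "{u :: 'k. u ^ m = 1}"
  have "finite ?U"
    using card_roots_of_unity[OF \<open>0 < m\<close>, where ?'k = 'k] \<open>0 < m\<close> card.infinite by fastforce
  from ex_bij_betw_nat_finite[OF this] obtain h where h: "bij_betw h {..<m} ?U"
    unfolding card_roots_of_unity[OF assms(1)] atLeast0LessThan by blast
  have "(y * h l) ^ m = c" if "l < m" for l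
    using bij_betwE[OF h] that by (simp add: power_mult_distrib y)
  moreover have "(\<Sum>l<m. (y * h l) ^ i) = 0" if "0 < i" "i < m" for i
  proof -
    have "(\<Sum>l<m. (y * h l) ^ i) = y ^ i * (\<Sum>l<m. h l ^ i)"
      by (simp add: power_mult_distrib sum_distrib_left)
    also have "(\<Sum>l<m. h l ^ i) = (\<Sum>u\<in>?U. u ^ i)"
      by (rule sum.reindex_bij_betw[OF h])
    finally show ?thesis by (simp add: sum_roots_of_unity_powers[OF that])
  qed
  ultimately show ?thesis by (rule that)
qed

text \<open>Numbers pairs \<open>(j, l)\<close> as \<open>s = j * m + l\<close>; this numbers the
  extended characters by (character of the subgroup, chosen root).\<close>

lemma sum_div_mod:
  fixes f :: "nat \<Rightarrow> nat \<Rightarrow> 'b :: comm_monoid_add"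
  shows "(\<Sum>s<k * m. f (s div m) (s mod m)) = (\<Sum>j<k. \<Sum>l<m. f j l)"
proof -
  have "(\<Sum>s = j * m..<j * m + m. f (s div m) (s mod m)) = (\<Sum>l<m. f j l)" for j
    using sum.shift_bounds_nat_ivl[of "\<lambda>s. f (s div m) (s mod m)" 0 "j * m" m]
    by (simp add: atLeast0LessThan add.commute)
  then show ?thesis
    by (simp flip: sum.nat_group)
qed

text \<open>The last condition is column orthogonality of the character table. Characters are
  numbered because \<open>tensor_rank\<close> indexes its summands by natural numbers.\<close>

definition complete_characters ::
    "('g, 'm) monoid_scheme \<Rightarrow> 'g set \<Rightarrow> (nat \<Rightarrow> 'g \<Rightarrow> 'k::field) \<Rightarrow> bool" where
  "complete_characters G H \<theta> \<longleftrightarrow>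
     (\<forall>s<card H. \<forall>a\<in>H. \<forall>b\<in>H. \<theta> s (a \<otimes>\<^bsub>G\<^esub> b) = \<theta> s a * \<theta> s b) \<and>
     (\<forall>s<card H. \<theta> s \<one>\<^bsub>G\<^esub> = 1) \<and>
     (\<forall>h\<in>H. (\<Sum>s<card H. \<theta> s h) = (if h = \<one>\<^bsub>G\<^esub> then of_nat (card H) else 0))"

text \<open>Every character of \<open>H\<close> has one extension to the subgroup generated by \<open>H\<close> and \<open>x\<close> for
  each root of order \<open>m\<close> of its value at \<open>x\<^sup>m\<close>, where \<open>m\<close> is the order of \<open>x\<close> modulo \<open>H\<close>.\<close>

lemma extend_characters:
  fixes \<theta> :: "nat \<Rightarrow> 'g \<Rightarrow> 'k :: {alg_closed_field, field_char_0}"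
  assumes "comm_group G" and fin: "finite (carrier G)" and H: "subgroup H G"
    and x: "x \<in> carrier G" "x \<notin> H" and \<theta>: "complete_characters G H \<theta>"
  shows "\<exists>K (\<psi> :: nat \<Rightarrow> 'g \<Rightarrow> 'k). subgroup K G \<and> H \<subset> K \<and> complete_characters G K \<psi>"
proof -
  interpret comm_group G by fact
  interpret H: subgroup H G by fact
  have HG: "h \<in> H \<Longrightarrow> h \<in> carrier G" for h by (rule H.mem_carrier)
  define m :: nat where "m = (LEAST m. m > 0 \<and> x [^]\<^bsub>G\<^esub> m \<in> H)"
  have "order G > 0 \<and> x [^]\<^bsub>G\<^esub> order G \<in> H"
    using pow_order_eq_1[OF x(1)] order_gt_0_iff_finite fin by simp
  then have "m > 0 \<and> x [^]\<^bsub>G\<^esub> m \<in> H"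
    unfolding m_def by (rule LeastI)
  then have m: "m > 0" "x [^]\<^bsub>G\<^esub> m \<in> H" by blast+
  have m_le: "m \<le> i" if "i > 0" "x [^]\<^bsub>G\<^esub> i \<in> H" for i :: nat
    unfolding m_def using that by (simp add: Least_le)
  define F where "F = (\<lambda>(h, i :: nat). h \<otimes>\<^bsub>G\<^esub> x [^]\<^bsub>G\<^esub> i)"
  define D where "D = H \<times> {..<m}"
  define K where "K = F ` D"
  \<comment> \<open>Uniqueness of the normal form \<open>h x^i\<close> with \<open>i < m\<close>:
    different exponents would put \<open>x^(j - i)\<close> into \<open>H\<close> with
    \<open>0 < j - i < m\<close>, against the minimality of \<open>m\<close>.\<close>
  have aux: "i = j \<and> h = h'"
    if "h \<in> H" "h' \<in> H" "i \<le> j" "j < m" "h \<otimes>\<^bsub>G\<^esub> x [^]\<^bsub>G\<^esub> i = h' \<otimes>\<^bsub>G\<^esub> x [^]\<^bsub>G\<^esub> j" for h h' i j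
  proof -
    have "h \<otimes>\<^bsub>G\<^esub> x [^]\<^bsub>G\<^esub> i = (h' \<otimes>\<^bsub>G\<^esub> x [^]\<^bsub>G\<^esub> (j - i)) \<otimes>\<^bsub>G\<^esub> x [^]\<^bsub>G\<^esub> i"
      using that HG x by (simp add: m_assoc nat_pow_mult)
    then have eq: "h = h' \<otimes>\<^bsub>G\<^esub> x [^]\<^bsub>G\<^esub> (j - i)"
      using that HG x by simp
    then have "x [^]\<^bsub>G\<^esub> (j - i) = inv\<^bsub>G\<^esub> h' \<otimes>\<^bsub>G\<^esub> h"
      using that HG x by (simp add: inv_solve_left)
    then have "x [^]\<^bsub>G\<^esub> (j - i) \<in> H" using that by simp
    then have "j - i = 0" using m_le[of "j - i"] that by fastforce
    then show ?thesis using eq that HG by simp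
  qed
  have inj: "inj_on F D"
  proof (rule inj_onI)
    fix p q assume "p \<in> D" "q \<in> D" "F p = F q"
    then show "p = q"
      using aux[of "fst p" "fst q" "snd p" "snd q"] aux[of "fst q" "fst p" "snd q" "snd p"]
      by (cases "snd p \<le> snd q") (auto simp: F_def D_def split: prod.splits)
  qed
  \<comment> \<open>An arbitrary exponent is reduced below \<open>m\<close> by absorbing powers of
    \<open>x^m\<close>, which lies in \<open>H\<close>, into the first factor.\<close>
  have split_pow: "h \<otimes>\<^bsub>G\<^esub> x [^]\<^bsub>G\<^esub> k = F (h \<otimes>\<^bsub>G\<^esub> (x [^]\<^bsub>G\<^esub> m) [^]\<^bsub>G\<^esub> (k div m), k mod m)" if "h \<in> H" for h k
  proof -
    have "x [^]\<^bsub>G\<^esub> k = (x [^]\<^bsub>G\<^esub> m) [^]\<^bsub>G\<^esub> (k div m) \<otimes>\<^bsub>G\<^esub> x [^]\<^bsub>G\<^esub> (k mod m)"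
      using x by (simp add: nat_pow_pow nat_pow_mult)
    then show ?thesis using that HG x by (simp add: F_def m_assoc)
  qed
  have powH: "(x [^]\<^bsub>G\<^esub> m) [^]\<^bsub>G\<^esub> (q :: nat) \<in> H" for q
    using m(2) by (induction q) auto
  have inD: "(h \<otimes>\<^bsub>G\<^esub> (x [^]\<^bsub>G\<^esub> m) [^]\<^bsub>G\<^esub> (k div m), k mod m) \<in> D" if "h \<in> H" for h k
    using that powH m by (simp add: D_def)
  have inK: "h \<otimes>\<^bsub>G\<^esub> x [^]\<^bsub>G\<^esub> (k :: nat) \<in> K" if "h \<in> H" for h k
    unfolding K_def split_pow[OF that] using inD[OF that] by blast
  have K_eq: "K = H <#>\<^bsub>G\<^esub> generate G {x}"
    using inK unfolding generate_pow_on_finite_carrier[OF fin x(1)] set_mult_def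
    by (auto simp: K_def F_def D_def)
  have subK: "subgroup K G"
    unfolding K_eq using x by (intro mult_subgroups H generate_is_subgroup) auto
  have "h \<in> K" if "h \<in> H" for h using inK[OF that, of 0] that HG by simp
  moreover have "x \<in> K" using inK[of "\<one>\<^bsub>G\<^esub>" 1] x by simp
  ultimately have HK: "H \<subset> K" using x by blast
  have cardK: "card K = card H * m"
    using card_image[OF inj] by (simp add: K_def D_def card_cartesian_product)
  have finH: "finite H" using fin H.subset finite_subset by blast
  have \<theta>_mult: "\<theta> s (a \<otimes>\<^bsub>G\<^esub> b) = \<theta> s a * \<theta> s b" if "s < card H" "a \<in> H" "b \<in> H" for s a b
    using \<theta> that by (simp add: complete_characters_def)
  have \<theta>_one: "\<theta> s \<one>\<^bsub>G\<^esub> = 1" if "s < card H" for s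
    using \<theta> that by (simp add: complete_characters_def)
  have \<theta>_pow: "\<theta> s (y [^]\<^bsub>G\<^esub> (q :: nat)) = \<theta> s y ^ q" if "s < card H" "y \<in> H" for s y q
  proof (induction q)
    case (Suc q)
    have "y [^]\<^bsub>G\<^esub> q \<in> H" using that(2) by (induction q) auto
    with Suc show ?case using that by (simp add: \<theta>_mult)
  qed (use that \<theta>_one in simp)
  have "\<exists>z :: nat \<Rightarrow> 'k. (\<forall>l<m. z l ^ m = \<theta> s (x [^]\<^bsub>G\<^esub> m)) \<and>
      (\<forall>i. 0 < i \<longrightarrow> i < m \<longrightarrow> (\<Sum>l<m. z l ^ i) = 0)" if "s < card H" for s
  proof -
    \<comment> \<open>Character values are invertible, hence nonzero.\<close>
    have "\<theta> s (x [^]\<^bsub>G\<^esub> m) * \<theta> s (inv\<^bsub>G\<^esub> (x [^]\<^bsub>G\<^esub> m)) = \<theta> s \<one>\<^bsub>G\<^esub>"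
      using \<theta>_mult[OF that m(2), of "inv\<^bsub>G\<^esub> (x [^]\<^bsub>G\<^esub> m)"] m(2) x by simp
    then have "\<theta> s (x [^]\<^bsub>G\<^esub> m) \<noteq> 0" using \<theta>_one[OF that] by auto
    from obtain_roots[OF m(1) this] obtain y :: "nat \<Rightarrow> 'k" where
      "\<And>l. l < m \<Longrightarrow> y l ^ m = \<theta> s (x [^]\<^bsub>G\<^esub> m)"
      "\<And>i. 0 < i \<Longrightarrow> i < m \<Longrightarrow> (\<Sum>l<m. y l ^ i) = 0" by blast
    then show ?thesis by blast
  qed
  then have "\<forall>s\<in>{..<card H}. \<exists>y :: nat \<Rightarrow> 'k. (\<forall>l<m. y l ^ m = \<theta> s (x [^]\<^bsub>G\<^esub> m)) \<and>
      (\<forall>i. 0 < i \<longrightarrow> i < m \<longrightarrow> (\<Sum>l<m. y l ^ i) = 0)" by blast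
  from bchoice[OF this] obtain z :: "nat \<Rightarrow> nat \<Rightarrow> 'k" where
    z: "\<And>s l. s < card H \<Longrightarrow> l < m \<Longrightarrow> z s l ^ m = \<theta> s (x [^]\<^bsub>G\<^esub> m)" and
    z_sum: "\<And>s i. s < card H \<Longrightarrow> 0 < i \<Longrightarrow> i < m \<Longrightarrow> (\<Sum>l<m. z s l ^ i) = 0"
    by blast
  \<comment> \<open>The extension of the \<open>j\<close>-th character that sends \<open>x\<close>
    to the \<open>l\<close>-th root; \<open>inv_into D F\<close> reads off the normal form.\<close>
  define E where "E = (\<lambda>j l y. case inv_into D F y of (h, i) \<Rightarrow> \<theta> j h * z j l ^ i)"
  \<comment> \<open>The formula holds for all exponents, not only \<open>k < m\<close>, because
    \<open>z j l ^ m\<close> is the value at \<open>x^m\<close>. Multiplicativity needs this, as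
    exponents add up beyond \<open>m\<close>.\<close>
  have E: "E j l (h \<otimes>\<^bsub>G\<^esub> x [^]\<^bsub>G\<^esub> k) = \<theta> j h * z j l ^ k"
    if "j < card H" "l < m" "h \<in> H" for j l h k
  proof -
    have "E j l (h \<otimes>\<^bsub>G\<^esub> x [^]\<^bsub>G\<^esub> k) = \<theta> j (h \<otimes>\<^bsub>G\<^esub> (x [^]\<^bsub>G\<^esub> m) [^]\<^bsub>G\<^esub> (k div m)) * z j l ^ (k mod m)"
      unfolding split_pow[OF that(3)] E_def by (simp add: inv_into_f_f[OF inj inD[OF that(3)]])
    also have "\<dots> = \<theta> j h * ((z j l ^ m) ^ (k div m) * z j l ^ (k mod m))"
      using that powH m by (simp add: \<theta>_mult \<theta>_pow z)
    also have "(z j l ^ m) ^ (k div m) * z j l ^ (k mod m) = z j l ^ k"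
      by (simp flip: power_mult power_add)
    finally show ?thesis .
  qed
  define \<psi> where "\<psi> s = E (s div m) (s mod m)" for s
  have bounds: "s div m < card H" "s mod m < m" if "s < card K" for s
    using that m by (simp_all add: cardK less_mult_imp_div_less)
  have "\<psi> s (a \<otimes>\<^bsub>G\<^esub> b) = \<psi> s a * \<psi> s b" if s: "s < card K" and ab: "a \<in> K" "b \<in> K" for s a b
  proof -
    obtain h i h' i' where
      a: "h \<in> H" "a = h \<otimes>\<^bsub>G\<^esub> x [^]\<^bsub>G\<^esub> (i :: nat)" and b: "h' \<in> H" "b = h' \<otimes>\<^bsub>G\<^esub> x [^]\<^bsub>G\<^esub> (i' :: nat)"
      using ab by (auto simp: K_def D_def F_def)
    have "a \<otimes>\<^bsub>G\<^esub> b = (h \<otimes>\<^bsub>G\<^esub> h') \<otimes>\<^bsub>G\<^esub> x [^]\<^bsub>G\<^esub> (i + i')"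
      using a b HG x by (simp add: nat_pow_mult[symmetric] m_ac)
    then show ?thesis
      using a b bounds[OF s] by (simp add: \<psi>_def E \<theta>_mult power_add)
  qed
  moreover have "\<psi> s \<one>\<^bsub>G\<^esub> = 1" if s: "s < card K" for s
    using E[OF bounds[OF s], of "\<one>\<^bsub>G\<^esub>" 0] \<theta>_one bounds[OF s] by (simp add: \<psi>_def)
  moreover have "(\<Sum>s<card K. \<psi> s y) = (if y = \<one>\<^bsub>G\<^esub> then of_nat (card K) else 0)"
    if "y \<in> K" for y
  proof -
    obtain h i where y: "h \<in> H" "i < m" "y = h \<otimes>\<^bsub>G\<^esub> x [^]\<^bsub>G\<^esub> (i :: nat)"
      using \<open>y \<in> K\<close> by (auto simp: K_def D_def F_def)
    have "(\<Sum>s<card K. \<psi> s y) = (\<Sum>j<card H. \<Sum>l<m. E j l y)"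
      unfolding \<psi>_def cardK by (rule sum_div_mod)
    also have "\<dots> = (\<Sum>j<card H. \<theta> j h * (\<Sum>l<m. z j l ^ i))"
      using y by (simp add: E sum_distrib_left)
    \<comment> \<open>For \<open>i = 0\<close> the inner sum is \<open>m\<close> and orthogonality
      on \<open>H\<close> applies; for \<open>0 < i < m\<close> the inner power sums vanish.\<close>
    also have "\<dots> = (if y = \<one>\<^bsub>G\<^esub> then of_nat (card K) else 0)"
    proof (cases "i = 0")
      case True
      have "y = h" using True y HG by simp
      have "(\<Sum>j<card H. \<theta> j h * (\<Sum>l<m. z j l ^ i)) = (\<Sum>j<card H. \<theta> j h) * of_nat m"
        by (simp add: True sum_distrib_right)
      then show ?thesis
        using \<theta> y \<open>y = h\<close> by (simp add: complete_characters_def cardK)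
    next
      case False
      have "y \<noteq> \<one>\<^bsub>G\<^esub>"
        using aux[of "\<one>\<^bsub>G\<^esub>" h 0 i] y False by auto
      then show ?thesis using False y by (simp add: z_sum)
    qed
    finally show ?thesis .
  qed
  ultimately have "complete_characters G K \<psi>" by (simp add: complete_characters_def)
  with subK HK show ?thesis by blast
qed

text \<open>A maximal subgroup with a complete family of characters must be all of \<open>G\<close>,
  since any smaller one can be enlarged by \<open>extend_characters\<close>.\<close>

lemma ex_complete_characters:
  assumes "comm_group G" and fin: "finite (carrier G)"
  shows "\<exists>\<theta> :: nat \<Rightarrow> 'g \<Rightarrow> 'k :: {alg_closed_field, field_char_0}.
    complete_characters G (carrier G) \<theta>"
proof -
  interpret comm_group G by fact
  define \<H> where "\<H> = {H. subgroup H G \<and>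
    (\<exists>\<theta> :: nat \<Rightarrow> 'g \<Rightarrow> 'k. complete_characters G H \<theta>)}"
  have "\<H> \<subseteq> Pow (carrier G)" by (auto simp: \<H>_def dest: subgroup.subset)
  then have fin\<H>: "finite \<H>" using fin finite_subset by blast
  \<comment> \<open>The trivial subgroup has the single character 1.\<close>
  have "{\<one>\<^bsub>G\<^esub>} \<in> \<H>"
    unfolding \<H>_def complete_characters_def
    by (auto intro!: triv_subgroup exI[of _ "\<lambda>_ _. 1"])
  then have "\<H> \<noteq> {}" by blast
  with fin\<H> obtain H where H: "H \<in> \<H>" and max: "\<And>K. K \<in> \<H> \<Longrightarrow> H \<subseteq> K \<Longrightarrow> H = K"
    using finite_has_maximal[of \<H>] by blast
  obtain \<theta> :: "nat \<Rightarrow> 'g \<Rightarrow> 'k" where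
    sub: "subgroup H G" and \<theta>: "complete_characters G H \<theta>"
    using H by (auto simp: \<H>_def)
  have "x \<in> H" if "x \<in> carrier G" for x
  proof (rule ccontr)
    assume "x \<notin> H"
    from extend_characters[OF assms sub that this \<theta>] obtain K where "K \<in> \<H>" "H \<subset> K"
      by (auto simp: \<H>_def)
    with max show False by blast
  qed
  then have "H = carrier G" using subgroup.subset[OF sub] by blast
  with \<theta> show ?thesis by blast
qed




section \<open>Isomorphisms given by matrices\<close>

text \<open>The value 0 outside \<open>J\<close> places the image in \<open>coord_space J\<close>,
  as \<open>linear_iso\<close> demands.\<close>

definition mat_map :: "'a set \<Rightarrow> 'b set \<Rightarrow> ('b \<Rightarrow> 'a \<Rightarrow> 'k::field) \<Rightarrow> ('a \<Rightarrow> 'k) \<Rightarrow> 'b \<Rightarrow> 'k" where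
  "mat_map I J M v = (\<lambda>b. if b \<in> J then \<Sum>a\<in>I. M b a * v a else 0)"

definition inverse_mats ::
    "'a set \<Rightarrow> 'b set \<Rightarrow> ('b \<Rightarrow> 'a \<Rightarrow> 'k::field) \<Rightarrow> ('a \<Rightarrow> 'b \<Rightarrow> 'k) \<Rightarrow> bool" where
  "inverse_mats I J M M' \<longleftrightarrow>
     (\<forall>b\<in>J. \<forall>b'\<in>J. (\<Sum>a\<in>I. M b a * M' a b') = (if b = b' then 1 else 0)) \<and>
     (\<forall>a\<in>I. \<forall>a'\<in>I. (\<Sum>b\<in>J. M' a b * M b a') = (if a = a' then 1 else 0))"

lemma inverse_mats_sym: "inverse_mats I J M M' \<Longrightarrow> inverse_mats J I M' M"
  by (auto simp: inverse_mats_def)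

lemma mat_map_inverse:
  assumes "finite I" "finite J" "inverse_mats I J M M'" "v \<in> coord_space I"
  shows "mat_map J I M' (mat_map I J M v) = v"
proof
  fix a
  show "mat_map J I M' (mat_map I J M v) a = v a"
  proof (cases "a \<in> I")
    case True
    have "mat_map J I M' (mat_map I J M v) a = (\<Sum>b\<in>J. \<Sum>a'\<in>I. M' a b * M b a' * v a')"
      using True by (simp add: mat_map_def sum_distrib_left mult.assoc)
    also have "\<dots> = (\<Sum>a'\<in>I. (\<Sum>b\<in>J. M' a b * M b a') * v a')"
      by (subst sum.swap) (simp add: sum_distrib_right)
    also have "\<dots> = (\<Sum>a'\<in>I. if a' = a then v a' else 0)"
      using assms(3) True by (intro sum.cong) (auto simp: inverse_mats_def)
    finally show ?thesis using True assms(1) by (simp add: sum.delta)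
  next
    case False
    then show ?thesis using assms(4) by (simp add: mat_map_def coord_space_def)
  qed
qed

lemma linear_iso_mat_map:
  assumes "finite I" "finite J" "inverse_mats I J M M'"
  shows "linear_iso I J (mat_map I J M)"
  unfolding linear_iso_def
proof (intro conjI ballI allI)
  show "bij_betw (mat_map I J M) (coord_space I) (coord_space J)"
    using mat_map_inverse[OF assms] mat_map_inverse[OF assms(2,1) inverse_mats_sym[OF assms(3)]]
    by (intro bij_betw_byWitness[where f' = "mat_map J I M'"])
       (auto simp: coord_space_def mat_map_def)
qed (auto simp: mat_map_def distrib_left sum.distrib sum_distrib_left mult.left_commute)

lemma mat_map_unit_vec:
  assumes "finite I" "a \<in> I" "b \<in> J"
  shows "mat_map I J M (unit_vec a) b = M b a"
proof -
  have "mat_map I J M (unit_vec a) b = (\<Sum>a'\<in>I. if a' = a then M b a' else 0)"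
    using assms(3) by (auto simp: mat_map_def unit_vec_def intro!: sum.cong)
  then show ?thesis using assms by (simp add: sum.delta)
qed

text \<open>A matrix sends a unit vector to one of its columns, so an isomorphism given by
  invertible matrices amounts to one identity between coordinates.\<close>

lemma tensor_iso_matI:
  assumes fin: "finite (idx1 T)" "finite (idx2 T)" "finite (idx3 T)"
    "finite (idx1 S)" "finite (idx2 S)" "finite (idx3 S)"
    and inv: "inverse_mats (idx1 T) (idx1 S) A A'" "inverse_mats (idx2 T) (idx2 S) B B'"
      "inverse_mats (idx3 T) (idx3 S) C C'"
    and eq: "\<And>k l m. k \<in> idx1 S \<Longrightarrow> l \<in> idx2 S \<Longrightarrow> m \<in> idx3 S \<Longrightarrow>
      (\<Sum>a\<in>idx1 T. \<Sum>b\<in>idx2 T. \<Sum>c\<in>idx3 T. coord T a b c * (A k a * B l b * C m c)) =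
      coord S k l m"
  shows "tensor_iso T S"
  unfolding tensor_iso_def
proof (intro exI conjI ballI)
  fix k l m assume klm: "k \<in> idx1 S" "l \<in> idx2 S" "m \<in> idx3 S"
  have "tensor_map (mat_map (idx1 T) (idx1 S) A) (mat_map (idx2 T) (idx2 S) B)
      (mat_map (idx3 T) (idx3 S) C) T k l m =
    (\<Sum>a\<in>idx1 T. \<Sum>b\<in>idx2 T. \<Sum>c\<in>idx3 T. coord T a b c * (A k a * B l b * C m c))"
    unfolding tensor_map_def pure_tensor_def using fin klm
    by (intro sum.cong refl) (simp add: mat_map_unit_vec)
  then show "tensor_map (mat_map (idx1 T) (idx1 S) A) (mat_map (idx2 T) (idx2 S) B)
      (mat_map (idx3 T) (idx3 S) C) T k l m = coord S k l m"
    using eq[OF klm] by simp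
qed (use fin inv in \<open>auto intro: linear_iso_mat_map\<close>)

section \<open>Words of a given type\<close>

text \<open>These are the index sets of a sweet piece.\<close>

definition typed_words :: "'a set \<Rightarrow> ('a \<Rightarrow> int) \<Rightarrow> nat \<Rightarrow> int pmf \<Rightarrow> 'a list set" where
  "typed_words I l N p = {xs. set xs \<subseteq> I \<and> length xs = N} \<inter> words_of_type l N p"

lemma finite_typed_words: "finite I \<Longrightarrow> finite (typed_words I l N p)"
  unfolding typed_words_def using finite_lists_length_eq by blast

lemma typed_words_nth: "xs \<in> typed_words I l N p \<Longrightarrow> i < N \<Longrightarrow> xs ! i \<in> I"
  by (auto simp: typed_words_def)

text \<open>The type of a word depends only on its sequence of labels.\<close>

lemma typed_words_transfer:
  assumes "ys \<in> typed_words J l' N p" "set xs \<subseteq> I" "length xs = N"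
    and "\<And>i. i < N \<Longrightarrow> l (xs ! i) = l' (ys ! i)"
  shows "xs \<in> typed_words I l N p"
proof -
  have "map l xs = map l' ys"
    using assms by (auto simp: typed_words_def intro: nth_equalityI)
  then show ?thesis using assms by (simp add: typed_words_def words_of_type_def)
qed

text \<open>Distributive law: a word records which summand is chosen in each factor. The induction
  splits off the first letter.\<close>

lemma prod_sum_words:
  fixes F :: "nat \<Rightarrow> 'a \<Rightarrow> 'c::comm_semiring_1"
  shows "(\<Sum>xs\<in>{xs. set xs \<subseteq> I \<and> length xs = N}. \<Prod>i<N. F i (xs ! i)) =
    (\<Prod>i<N. \<Sum>a\<in>I. F i a)"
proof (induction N arbitrary: F)
  case 0
  have "{xs. set xs \<subseteq> I \<and> length xs = 0} = {[]}" by auto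
  then show ?case by simp
next
  case (Suc N)
  let ?W = "\<lambda>N. {xs. set xs \<subseteq> I \<and> length xs = N}"
  have bij: "bij_betw (\<lambda>(a, xs). a # xs) (I \<times> ?W N) (?W (Suc N))"
    by (intro bij_betw_byWitness[where f' = "\<lambda>xs. (hd xs, tl xs)"])
       (auto simp: length_Suc_conv)
  have "(\<Sum>xs\<in>?W (Suc N). \<Prod>i<Suc N. F i (xs ! i)) =
      (\<Sum>(a, xs)\<in>I \<times> ?W N. F 0 a * (\<Prod>i<N. F (Suc i) (xs ! i)))"
    by (subst sum.reindex_bij_betw[OF bij, symmetric])
       (simp add: prod.lessThan_Suc_shift case_prod_beta del: prod.lessThan_Suc)
  also have "\<dots> = (\<Sum>a\<in>I. F 0 a) * (\<Sum>xs\<in>?W N. \<Prod>i<N. F (Suc i) (xs ! i))"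
    by (simp add: sum_product sum.cartesian_product)
  also have "\<dots> = (\<Prod>i<Suc N. \<Sum>a\<in>I. F i a)"
    by (simp add: Suc.IH[of "\<lambda>i. F (Suc i)"] prod.lessThan_Suc_shift del: prod.lessThan_Suc)
  finally show ?case .
qed

text \<open>A nonzero term forces \<open>xs\<close> to have the labels of \<open>ys\<close> position
  by position, hence the same type. Restricting to typed words therefore loses nothing, and the sum
  still factors over positions.\<close>

lemma sum_typed_words:
  fixes F :: "nat \<Rightarrow> 'a \<Rightarrow> 'k::field"
  assumes "finite I" "ys \<in> typed_words J l' N p"
    and F: "\<And>i a. i < N \<Longrightarrow> a \<in> I \<Longrightarrow> F i a \<noteq> 0 \<Longrightarrow> l a = l' (ys ! i)"
  shows "(\<Sum>xs\<in>typed_words I l N p. \<Prod>i<N. F i (xs ! i)) = (\<Prod>i<N. \<Sum>a\<in>I. F i a)"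
proof -
  let ?W = "{xs. set xs \<subseteq> I \<and> length xs = N}"
  have "(\<Prod>i<N. F i (xs ! i)) = 0" if "xs \<in> ?W - typed_words I l N p" for xs
  proof (rule ccontr)
    assume "(\<Prod>i<N. F i (xs ! i)) \<noteq> 0"
    then have "l (xs ! i) = l' (ys ! i)" if "i < N" for i
      using that \<open>xs \<in> _\<close> by (intro F) auto
    then have "xs \<in> typed_words I l N p"
      using that by (intro typed_words_transfer[OF assms(2)]) auto
    with that show False by blast
  qed
  then have "(\<Sum>xs\<in>typed_words I l N p. \<Prod>i<N. F i (xs ! i)) = (\<Sum>xs\<in>?W. \<Prod>i<N. F i (xs ! i))"
    using assms(1) by (intro sum.mono_neutral_left finite_lists_length_eq) (auto simp: typed_words_def)
  then show ?thesis by (simp add: prod_sum_words)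
qed

text \<open>The \<open>N\<close>-th Kronecker power of the matrix \<open>M\<close>.\<close>

definition word_mat :: "nat \<Rightarrow> ('b \<Rightarrow> 'a \<Rightarrow> 'k::field) \<Rightarrow> 'b list \<Rightarrow> 'a list \<Rightarrow> 'k" where
  "word_mat N M ys xs = (\<Prod>i<N. M (ys ! i) (xs ! i))"

text \<open>That is, \<open>M\<close> is block diagonal with respect to the labels, so that its
  Kronecker powers restrict to words of a given type.\<close>

definition label_preserving ::
    "'a set \<Rightarrow> 'b set \<Rightarrow> ('a \<Rightarrow> int) \<Rightarrow> ('b \<Rightarrow> int) \<Rightarrow> ('b \<Rightarrow> 'a \<Rightarrow> 'k::field) \<Rightarrow> bool" where
  "label_preserving I J l l' M \<longleftrightarrow> (\<forall>b\<in>J. \<forall>a\<in>I. M b a \<noteq> 0 \<longrightarrow> l a = l' b)"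

lemma label_preserving_transpose:
  "label_preserving I J l l' M \<Longrightarrow> label_preserving J I l' l (\<lambda>a k. M k a)"
  by (simp add: label_preserving_def)

text \<open>Kronecker powers multiply position by position; by block diagonality this survives the
  restriction to typed words.\<close>

lemma word_mat_mult:
  assumes "finite I" "label_preserving I J l l' M"
    and inv: "\<And>b b'. b \<in> J \<Longrightarrow> b' \<in> J \<Longrightarrow> (\<Sum>a\<in>I. M b a * M' a b') = (if b = b' then 1 else 0)"
    and ys: "ys \<in> typed_words J l' N p" and zs: "zs \<in> typed_words J l' N p"
  shows "(\<Sum>xs\<in>typed_words I l N p. word_mat N M ys xs * word_mat N M' xs zs) =
    (if ys = zs then 1 else 0)"
proof -
  have "(\<Sum>xs\<in>typed_words I l N p. word_mat N M ys xs * word_mat N M' xs zs) =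
      (\<Sum>xs\<in>typed_words I l N p. \<Prod>i<N. M (ys ! i) (xs ! i) * M' (xs ! i) (zs ! i))"
    by (simp add: word_mat_def prod.distrib)
  also have "\<dots> = (\<Prod>i<N. \<Sum>a\<in>I. M (ys ! i) a * M' a (zs ! i))"
    using assms(2) typed_words_nth[OF ys]
    by (intro sum_typed_words[OF assms(1) ys]) (auto simp: label_preserving_def)
  also have "\<dots> = (\<Prod>i<N. if ys ! i = zs ! i then 1 else 0)"
    using typed_words_nth[OF ys] typed_words_nth[OF zs] by (intro prod.cong) (auto simp: inv)
  also have "\<dots> = (if ys = zs then 1 else 0)"
  proof (cases "ys = zs")
    case False
    have "length ys = N" "length zs = N" using ys zs by (auto simp: typed_words_def)
    with False obtain i where "i < N" "ys ! i \<noteq> zs ! i" using nth_equalityI by metis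
    then show ?thesis using False by (auto intro!: prod_zero)
  qed simp
  finally show ?thesis .
qed

lemma inverse_mats_word_mat:
  assumes fin: "finite I" "finite J" and lab: "label_preserving I J l l' M" "label_preserving J I l' l M'"
    and inv: "inverse_mats I J M M'"
  shows "inverse_mats (typed_words I l N p) (typed_words J l' N p) (word_mat N M) (word_mat N M')"
  unfolding inverse_mats_def
proof (intro conjI ballI)
  show "(\<Sum>xs\<in>typed_words I l N p. word_mat N M ys xs * word_mat N M' xs zs) =
      (if ys = zs then 1 else 0)"
    if "ys \<in> typed_words J l' N p" "zs \<in> typed_words J l' N p" for ys zs
    using inv that by (intro word_mat_mult[OF fin(1) lab(1)]) (auto simp: inverse_mats_def)
  show "(\<Sum>ys\<in>typed_words J l' N p. word_mat N M' xs ys * word_mat N M ys zs) =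
      (if xs = zs then 1 else 0)"
    if "xs \<in> typed_words I l N p" "zs \<in> typed_words I l N p" for xs zs
    using inv that by (intro word_mat_mult[OF fin(2) lab(2)]) (auto simp: inverse_mats_def)
qed

text \<open>Applying Kronecker powers to a Kronecker power acts on each position separately. The
  three word sums are factored from the innermost outwards with
  \<open>sum_typed_words\<close>.\<close>

lemma tensor_map_words:
  fixes t :: "'a \<Rightarrow> 'a \<Rightarrow> 'a \<Rightarrow> 'k::field"
  assumes fin: "finite I1" "finite I2" "finite I3"
    and lab: "label_preserving I1 J1 l1 l1' A" "label_preserving I2 J2 l2 l2' B"
      "label_preserving I3 J3 l3 l3' C"
    and w: "ks \<in> typed_words J1 l1' N p1" "ls \<in> typed_words J2 l2' N p2"
      "ms \<in> typed_words J3 l3' N p3"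
  shows "(\<Sum>xs\<in>typed_words I1 l1 N p1. \<Sum>ys\<in>typed_words I2 l2 N p2. \<Sum>zs\<in>typed_words I3 l3 N p3.
      (\<Prod>i<N. t (xs ! i) (ys ! i) (zs ! i)) *
      (word_mat N A ks xs * word_mat N B ls ys * word_mat N C ms zs)) =
    (\<Prod>i<N. \<Sum>a\<in>I1. \<Sum>b\<in>I2. \<Sum>c\<in>I3. t a b c * (A (ks ! i) a * B (ls ! i) b * C (ms ! i) c))"
    (is "?L = _")
proof -
  note nth = typed_words_nth[OF w(1)] typed_words_nth[OF w(2)] typed_words_nth[OF w(3)]
  let ?F = "\<lambda>i a b c. t a b c * (A (ks ! i) a * B (ls ! i) b * C (ms ! i) c)"
  have nz: "l1 a = l1' (ks ! i)" if "i < N" "a \<in> I1" "A (ks ! i) a \<noteq> 0" for i a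
    using lab(1) nth that by (simp add: label_preserving_def)
  have nz2: "l2 a = l2' (ls ! i)" if "i < N" "a \<in> I2" "B (ls ! i) a \<noteq> 0" for i a
    using lab(2) nth that by (simp add: label_preserving_def)
  have nz3: "l3 a = l3' (ms ! i)" if "i < N" "a \<in> I3" "C (ms ! i) a \<noteq> 0" for i a
    using lab(3) nth that by (simp add: label_preserving_def)
  have "?L = (\<Sum>xs\<in>typed_words I1 l1 N p1. \<Sum>ys\<in>typed_words I2 l2 N p2.
      \<Sum>zs\<in>typed_words I3 l3 N p3. \<Prod>i<N. ?F i (xs ! i) (ys ! i) (zs ! i))"
    by (simp add: word_mat_def prod.distrib)
  also have "\<dots> = (\<Sum>xs\<in>typed_words I1 l1 N p1. \<Sum>ys\<in>typed_words I2 l2 N p2.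
      \<Prod>i<N. \<Sum>c\<in>I3. ?F i (xs ! i) (ys ! i) c)"
    by (intro sum.cong refl sum_typed_words[OF fin(3) w(3)] nz3) auto
  also have "\<dots> = (\<Sum>xs\<in>typed_words I1 l1 N p1. \<Prod>i<N. \<Sum>b\<in>I2. \<Sum>c\<in>I3. ?F i (xs ! i) b c)"
    by (intro sum.cong refl sum_typed_words[OF fin(2) w(2)] nz2) auto
  also have "\<dots> = (\<Prod>i<N. \<Sum>a\<in>I1. \<Sum>b\<in>I2. \<Sum>c\<in>I3. ?F i a b c)"
    by (intro sum_typed_words[OF fin(1) w(1)] nz) auto
  finally show ?thesis .
qed

section \<open>Total label sums of typed words\<close>

text \<open>The type prescribes how often each label occurs, so the total label is \<open>N\<close>
  times the mean of \<open>p\<close>.\<close>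

lemma sum_labels_words_of_type:
  assumes "xs \<in> words_of_type l N p" "finite (set_pmf p)"
  shows "real_of_int (\<Sum>i<length xs. l (xs ! i)) = real N * measure_pmf.expectation p real_of_int"
proof -
  let ?A = "set (map l xs) \<union> set_pmf p"
  have "real_of_int (\<Sum>i<length xs. l (xs ! i)) = (\<Sum>i<length xs. real_of_int (map l xs ! i))"
    by simp
  also have "\<dots> = sum_list (map real_of_int (map l xs))"
    by (simp add: sum_list_sum_nth atLeast0LessThan)
  also have "\<dots> = (\<Sum>a\<in>?A. real (count_list (map l xs) a) * real_of_int a)"
  proof -
    have *: "sum_list (map real_of_int ys) = (\<Sum>a\<in>A. real (count_list ys a) * real_of_int a)"
      if "finite A" "set ys \<subseteq> A" for ys A
      using that
    proof (induction ys)
      case (Cons y ys)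
      have "(\<Sum>a\<in>A. real (count_list (y # ys) a) * real_of_int a) =
          (\<Sum>a\<in>A. (if a = y then real_of_int a else 0) + real (count_list ys a) * real_of_int a)"
        by (intro sum.cong) (auto simp: algebra_simps)
      then show ?case using Cons by (simp add: sum.distrib sum.delta)
    qed simp
    show ?thesis using assms(2) by (intro *) auto
  qed
  also have "\<dots> = real N * (\<Sum>a\<in>?A. real_of_int a * pmf p a)"
    using assms(1) by (simp add: words_of_type_def sum_distrib_left mult.commute mult.left_commute)
  also have "(\<Sum>a\<in>?A. real_of_int a * pmf p a) = measure_pmf.expectation p real_of_int"
    using assms(2) by (intro integral_measure_pmf_real[symmetric]) auto
  finally show ?thesis .
qed

text \<open>By linearity of expectation the means of the three marginals add up to the mean of
  \<open>a + b + c\<close> under \<open>P\<close>, which is 0.\<close>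

lemma sum_labels_eq_0:
  assumes P: "finite (set_pmf P)" "\<And>a b c. (a, b, c) \<in> set_pmf P \<Longrightarrow> a + b + c = 0"
    and w: "ks \<in> typed_words J1 l1 N (marginal1 P)" "ls \<in> typed_words J2 l2 N (marginal2 P)"
      "ms \<in> typed_words J3 l3 N (marginal3 P)"
  shows "(\<Sum>i<N. l1 (ks ! i) + l2 (ls ! i) + l3 (ms ! i)) = 0"
proof -
  let ?E = "\<lambda>f. measure_pmf.expectation P (\<lambda>x. real_of_int (f x))"
  have fin: "finite (set_pmf (marginal1 P))" "finite (set_pmf (marginal2 P))"
    "finite (set_pmf (marginal3 P))"
    using P(1) by (simp_all add: marginal1_def marginal2_def marginal3_def)
  have len: "length ks = N" "length ls = N" "length ms = N"
    and ty: "ks \<in> words_of_type l1 N (marginal1 P)" "ls \<in> words_of_type l2 N (marginal2 P)"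
      "ms \<in> words_of_type l3 N (marginal3 P)"
    using w by (auto simp: typed_words_def)
  note eqs = sum_labels_words_of_type[OF ty(1) fin(1)] sum_labels_words_of_type[OF ty(2) fin(2)]
    sum_labels_words_of_type[OF ty(3) fin(3)]
  have "real_of_int (\<Sum>i<N. l1 (ks ! i) + l2 (ls ! i) + l3 (ms ! i)) =
      real N * (?E (\<lambda>(a, b, c). a) + ?E (\<lambda>(a, b, c). b) + ?E (\<lambda>(a, b, c). c))"
    using eqs unfolding len marginal1_def marginal2_def marginal3_def integral_map_pmf
    by (simp add: sum.distrib distrib_left)
  also have "?E (\<lambda>(a, b, c). a) + ?E (\<lambda>(a, b, c). b) + ?E (\<lambda>(a, b, c). c) =
      measure_pmf.expectation P (\<lambda>x. real_of_int ((\<lambda>(a, b, c). a) x) +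
        real_of_int ((\<lambda>(a, b, c). b) x) + real_of_int ((\<lambda>(a, b, c). c) x))"
    using P(1) by (simp add: Bochner_Integration.integral_add integrable_measure_pmf_finite)
  also have "\<dots> = measure_pmf.expectation P (\<lambda>_. 0)"
  proof (intro integral_cong_AE)
    show "AE x in measure_pmf P. real_of_int ((\<lambda>(a, b, c). a) x) +
        real_of_int ((\<lambda>(a, b, c). b) x) + real_of_int ((\<lambda>(a, b, c). c) x) = 0"
      using P(2) by (fastforce simp: AE_measure_pmf_iff simp flip: of_int_add)
  qed auto
  finally show ?thesis by (simp del: of_int_sum of_int_add)
qed

text \<open>Either some weight is negative and both products contain a zero factor, or all weights
  are nonnegative with sum 0, hence all 0, and the factors agree. The factors need not agree at
  positive weight, where \<open>T_G\<close> has entries that \<open>CW_n\<close> lacks.\<close>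

lemma prod_eq_if_sum_eq_0:
  fixes w :: "nat \<Rightarrow> int" and f h :: "nat \<Rightarrow> 'k::field"
  assumes "(\<Sum>i<N. w i) = 0"
    and "\<And>i. i < N \<Longrightarrow> w i \<le> 0 \<Longrightarrow> f i = h i" "\<And>i. i < N \<Longrightarrow> w i < 0 \<Longrightarrow> h i = 0"
  shows "(\<Prod>i<N. f i) = (\<Prod>i<N. h i)"
proof (cases "\<exists>i<N. w i < 0")
  case True
  then obtain i where "i < N" "w i < 0" by blast
  with assms(2)[of i] assms(3)[of i] have "f i = 0" "h i = 0" "i \<in> {..<N}" by auto
  then show ?thesis by (simp add: prod_zero[of "{..<N}"] bexI[of _ i])
next
  case False
  then have "\<And>i. i \<in> {..<N} \<Longrightarrow> 0 \<le> w i" by (meson lessThan_iff not_less)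
  then have "\<forall>i\<in>{..<N}. w i = 0"
    using assms(1) sum_nonneg_eq_0_iff[of "{..<N}" w] by blast
  then show ?thesis using assms(2) by (intro prod.cong) auto
qed

lemma sum_product3:
  fixes f :: "'a \<Rightarrow> 'd::comm_semiring_0"
  shows "(\<Sum>a\<in>X. f a) * (\<Sum>b\<in>Y. h b) * (\<Sum>c\<in>Z. w c) =
    (\<Sum>a\<in>X. \<Sum>b\<in>Y. \<Sum>c\<in>Z. f a * h b * w c)"
  by (simp only: mult.assoc sum_distrib_right) (simp only: sum_distrib_left)

text \<open>Expanding the product gives one term for each of the \<open>n ^ N\<close> words over
  \<open>{..<n}\<close>, and a product of pure tensors over the positions is again pure.\<close>

lemma tensor_rank_prod_le:
  fixes T :: "('a list, 'k::field) tensor"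
  assumes "\<And>xs ys zs. xs \<in> idx1 T \<Longrightarrow> ys \<in> idx2 T \<Longrightarrow> zs \<in> idx3 T \<Longrightarrow>
    coord T xs ys zs = (\<Prod>i<N. \<Sum>s<n. pure_tensor (u s) (v s) (w s) (xs ! i) (ys ! i) (zs ! i))"
  shows "tensor_rank T \<le> n ^ N"
proof -
  let ?W = "{ss. set ss \<subseteq> {..<n} \<and> length ss = N}"
  have "finite ?W" "card ?W = n ^ N"
    by (simp_all add: finite_lists_length_eq card_lists_length_eq)
  then obtain h where h: "bij_betw h {..<n ^ N} ?W"
    using ex_bij_betw_nat_finite[of ?W] by (auto simp: atLeast0LessThan)
  define lift where "lift f r xs = (\<Prod>i<N. f (h r ! i) (xs ! i))"
    for f :: "nat \<Rightarrow> 'a \<Rightarrow> 'k" and r xs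
  have "coord T xs ys zs = (\<Sum>r<n ^ N. pure_tensor (lift u r) (lift v r) (lift w r) xs ys zs)"
    if "xs \<in> idx1 T" "ys \<in> idx2 T" "zs \<in> idx3 T" for xs ys zs
  proof -
    have "coord T xs ys zs = (\<Sum>ss\<in>?W. \<Prod>i<N.
        pure_tensor (u (ss ! i)) (v (ss ! i)) (w (ss ! i)) (xs ! i) (ys ! i) (zs ! i))"
      unfolding assms[OF that] by (rule prod_sum_words[symmetric])
    also have "\<dots> = (\<Sum>r<n ^ N. pure_tensor (lift u r) (lift v r) (lift w r) xs ys zs)"
      by (subst sum.reindex_bij_betw[OF h, symmetric])
         (simp add: lift_def pure_tensor_def prod.distrib)
    finally show ?thesis .
  qed
  then show ?thesis
    unfolding tensor_rank_def by (intro Least_le) blast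
qed


section \<open>Diagonalising an involution\<close>

text \<open>Rows are indexed through \<open>s\<close>. If \<open>s k\<close> is a fixed point of
  \<tau>, both summands hit the same entry and add up to 1, so the row is a unit vector.\<close>

definition involution_mat :: "'k::field \<Rightarrow> ('b \<Rightarrow> 'a) \<Rightarrow> ('a \<Rightarrow> 'a) \<Rightarrow> 'b \<Rightarrow> 'a \<Rightarrow> 'k" where
  "involution_mat \<alpha> s \<tau> k a = (if a = s k then \<alpha> else 0) + (if a = \<tau> (s k) then 1 - \<alpha> else 0)"

lemma sum_involution_mat:
  assumes "finite I" "\<And>a. a \<in> I \<Longrightarrow> \<tau> a \<in> I" "s k \<in> I"
  shows "(\<Sum>a\<in>I. involution_mat \<alpha> s \<tau> k a * f a) = \<alpha> * f (s k) + (1 - \<alpha>) * f (\<tau> (s k))"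
proof -
  have "(\<Sum>a\<in>I. involution_mat \<alpha> s \<tau> k a * f a) =
      (\<Sum>a\<in>I. (if a = s k then \<alpha> * f a else 0) + (if a = \<tau> (s k) then (1 - \<alpha>) * f a else 0))"
    by (intro sum.cong) (auto simp: involution_mat_def distrib_right)
  then show ?thesis using assms by (simp add: sum.distrib sum.delta)
qed

text \<open>With \<open>\<beta> = 1 - \<alpha>\<close> the matrix is \<open>\<alpha> 1 + \<beta> J\<close>, where \<open>J\<close> is the permutation matrix of the
  involution. Since \<open>2 \<alpha> \<beta> = 1\<close> and hence \<open>\<alpha>\<^sup>2 + \<beta>\<^sup>2 = 0\<close>, one gets
  \<open>(\<alpha> 1 + \<beta> J) J (\<alpha> 1 + \<beta> J) = 1\<close>: the bilinear form \<open>J\<close> is diagonalised.\<close>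

lemma inverse_mats_involution_mat:
  fixes \<alpha> :: "'k::field"
  assumes \<alpha>: "2 * \<alpha> * (1 - \<alpha>) = 1"
    and I: "finite I" and s: "bij_betw s J I"
    and \<tau>: "\<And>a. a \<in> I \<Longrightarrow> \<tau> a \<in> I" "\<And>a. a \<in> I \<Longrightarrow> \<tau> (\<tau> a) = a"
  shows "inverse_mats I J (involution_mat \<alpha> s \<tau>) (\<lambda>a k. involution_mat \<alpha> s \<tau> k (\<tau> a))"
    and "inverse_mats I J (\<lambda>k a. involution_mat \<alpha> s \<tau> k (\<tau> a)) (\<lambda>a k. involution_mat \<alpha> s \<tau> k a)"
proof -
  let ?A = "involution_mat \<alpha> s \<tau>"
  have sq: "\<alpha> * \<alpha> + (1 - \<alpha>) * (1 - \<alpha>) = 0"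
    using \<alpha> by (simp add: algebra_simps)
  \<comment> \<open>All entries of the products in one formula: \<open>P\<close> alone gives the sum
    of squares 0, \<open>Q\<close> alone gives \<open>2 * \<alpha> * (1 - \<alpha>) = 1\<close>, and
    both together, at a fixed point, give 1.\<close>
  have comb: "\<alpha> * ((if P then \<alpha> else 0) + (if Q then 1 - \<alpha> else 0)) +
      (1 - \<alpha>) * ((if Q then \<alpha> else 0) + (if P then 1 - \<alpha> else 0)) = (if Q then 1 else 0)" for P Q
    using \<alpha> sq by (auto simp: algebra_simps)
  have sI: "k \<in> J \<Longrightarrow> s k \<in> I" for k using bij_betwE[OF s] by blast
  have s_eq: "s k = s l \<longleftrightarrow> k = l" if "k \<in> J" "l \<in> J" for k l
    by (rule inj_on_eq_iff[OF bij_betw_imp_inj_on[OF s] that])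
  have \<tau>_eq: "\<tau> a = b \<longleftrightarrow> a = \<tau> b" if "a \<in> I" "b \<in> I" for a b using \<tau> that by metis
  have rows: "(\<Sum>a\<in>I. ?A k a * ?A l (\<tau> a)) = (if k = l then 1 else 0)" if "k \<in> J" "l \<in> J" for k l
  proof -
    have "(\<Sum>a\<in>I. ?A k a * ?A l (\<tau> a)) = \<alpha> * ?A l (\<tau> (s k)) + (1 - \<alpha>) * ?A l (\<tau> (\<tau> (s k)))"
      using I \<tau> sI that by (intro sum_involution_mat) auto
    also have "\<dots> = (if k = l then 1 else 0)"
    proof -
      have "\<tau> (s k) = \<tau> (s l) \<longleftrightarrow> k = l" "s k = \<tau> (s l) \<longleftrightarrow> \<tau> (s k) = s l"
        "\<tau> (\<tau> (s k)) = s k" "s k = s l \<longleftrightarrow> k = l"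
        using that \<tau>_eq[of "s k" "\<tau> (s l)"] \<tau>_eq[of "s k" "s l"] by (simp_all add: \<tau> sI s_eq)
      then show ?thesis
        using comb[of "\<tau> (s k) = s l" "k = l"] by (simp only: involution_mat_def)
    qed
    finally show ?thesis .
  qed
  have cols: "(\<Sum>k\<in>J. ?A k (\<tau> a) * ?A k b) = (if a = b then 1 else 0)" if "a \<in> I" "b \<in> I" for a b
  proof -
    \<comment> \<open>Up to the relabelling \<open>s\<close> the matrix is symmetric, so a sum over
      the row index becomes one over \<open>I\<close>, to which \<open>sum_involution_mat\<close>
      applies.\<close>
    have sym: "?A k x = involution_mat \<alpha> id \<tau> x (s k)" if "k \<in> J" "x \<in> I" for k x
      using \<tau>_eq[of "s k" x] sI[OF that(1)] that(2) by (auto simp: involution_mat_def)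
    have "(\<Sum>k\<in>J. ?A k (\<tau> a) * ?A k b) =
        (\<Sum>k\<in>J. involution_mat \<alpha> id \<tau> (\<tau> a) (s k) * involution_mat \<alpha> id \<tau> b (s k))"
      using that \<tau> by (intro sum.cong) (auto simp: sym)
    also have "\<dots> = (\<Sum>x\<in>I. involution_mat \<alpha> id \<tau> (\<tau> a) x * involution_mat \<alpha> id \<tau> b x)"
      by (rule sum.reindex_bij_betw[OF s])
    also have "\<dots> = \<alpha> * involution_mat \<alpha> id \<tau> b (\<tau> a) + (1 - \<alpha>) * involution_mat \<alpha> id \<tau> b a"
      using I \<tau> that by (subst sum_involution_mat) auto
    also have "\<dots> = (if a = b then 1 else 0)"
    proof -
      have "\<tau> a = \<tau> b \<longleftrightarrow> a = b" "a = \<tau> b \<longleftrightarrow> \<tau> a = b"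
        using that \<tau>_eq[of a "\<tau> b"] \<tau>_eq[of a b] by (simp_all add: \<tau>)
      then show ?thesis
        using comb[of "\<tau> a = b" "a = b"] by (simp only: involution_mat_def id_apply)
    qed
    finally show ?thesis .
  qed
  show "inverse_mats I J ?A (\<lambda>a k. ?A k (\<tau> a))"
    using rows cols by (simp add: inverse_mats_def)
  show "inverse_mats I J (\<lambda>k a. ?A k (\<tau> a)) (\<lambda>a k. ?A k a)"
    unfolding inverse_mats_def using rows cols by (auto simp: mult.commute)
qed

section \<open>Coordinates of the two tensors and of their sweet pieces\<close>

lemma group_tensor_coord:
  assumes "finite (carrier G)" "a \<in> carrier G" "b \<in> carrier G" "c \<in> carrier G"
  shows "coord (group_tensor G :: ('g, 'k::field) tensor) a b c = (if a \<otimes>\<^bsub>G\<^esub> b = c then 1 else 0)"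
proof -
  let ?S = "{(g1, g2, g3). g1 \<in> carrier G \<and> g2 \<in> carrier G \<and> g3 \<in> carrier G \<and> g1 \<otimes>\<^bsub>G\<^esub> g2 = g3}"
  have "?S \<subseteq> carrier G \<times> carrier G \<times> carrier G" by auto
  then have "finite ?S" using assms(1) finite_subset by blast
  have "coord (group_tensor G :: ('g, 'k) tensor) a b c =
      (\<Sum>x\<in>?S. if x = (a, b, c) then 1 else 0)"
    unfolding group_tensor_def by (auto simp: pure_tensor_def unit_vec_def intro!: sum.cong)
  then show ?thesis using \<open>finite ?S\<close> assms by (simp add: sum.delta)
qed

lemma group_tensor_idx [simp]:
  "idx1 (group_tensor G) = carrier G" "idx2 (group_tensor G) = carrier G"
  "idx3 (group_tensor G) = carrier G"
  by (simp_all add: group_tensor_def)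

lemma CW_tensor_idx [simp]:
  "idx1 (CW_tensor n) = {1..n}" "idx2 (CW_tensor n) = {1..n}" "idx3 (CW_tensor n) = {1..n}"
  by (simp_all add: CW_tensor_def)

lemma sweet_piece_idx:
  "idx1 (sweet_piece lo hi P N T) = typed_words (idx1 T) (label lo hi) N (marginal1 P)"
  "idx2 (sweet_piece lo hi P N T) = typed_words (idx2 T) (label lo hi) N (marginal2 P)"
  "idx3 (sweet_piece lo hi P N T) = typed_words (idx3 T) (label hi lo) N (marginal3 P)"
  by (simp_all add: sweet_piece_def coord_projection_def kronecker_power_def typed_words_def)

lemma sweet_piece_coord:
  "coord (sweet_piece lo hi P N T) xs ys zs = (\<Prod>i<N. coord T (xs ! i) (ys ! i) (zs ! i))"
  by (simp add: sweet_piece_def coord_projection_def kronecker_power_def)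

text \<open>Matches the two basis vectors with labels -2 and 4, so that the enumeration carries one
  blocking to the other.\<close>

lemma obtain_bij_with_endpoints:
  assumes "finite A" "card A = n" "x \<in> A" "y \<in> A" "x \<noteq> y"
  obtains s :: "nat \<Rightarrow> 'a" where "bij_betw s {1..n} A" "s 1 = x" "s n = y"
proof -
  have "card {x, y} \<le> card A" using assms by (intro card_mono) auto
  then have n: "n \<ge> 2" using assms by simp
  have "card {2..n - 1} = card (A - {x, y})"
    using assms n by (simp add: card_Diff_subset)
  then obtain h where h: "bij_betw h {2..n - 1} (A - {x, y})"
    using finite_same_card_bij[of "{2..n - 1}" "A - {x, y}"] assms by auto
  define s where "s k = (if k = 1 then x else if k = n then y else h k)" for k
  have "bij_betw s {2..n - 1} (A - {x, y})"
    using h by (rule bij_betw_cong[THEN iffD1, rotated]) (auto simp: s_def)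
  moreover have "bij_betw s {1, n} {x, y}"
    using assms n by (auto simp: bij_betw_def s_def)
  ultimately have "bij_betw s ({2..n - 1} \<union> {1, n}) (A - {x, y} \<union> {x, y})"
    by (rule bij_betw_combine) auto
  moreover have "{2..n - 1} \<union> {1, n} = {1..n}" "A - {x, y} \<union> {x, y} = A"
    using n assms by auto
  ultimately have "bij_betw s {1..n} A" by simp
  moreover have "s 1 = x" "s n = y" using n by (auto simp: s_def)
  ultimately show ?thesis by (rule that)
qed

section \<open>Sweet pieces of the two tensors\<close>

text \<open>The condition on \<alpha> says that \<alpha> is \<open>(1 + i) / 2\<close> for a square
  root \<open>i\<close> of -1.\<close>

locale blocked_group = comm_group G for G (structure) +
  fixes g :: 'a and n :: nat and s :: "nat \<Rightarrow> 'a" and \<alpha> :: "'k::field"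
  assumes fin: "finite (carrier G)" and g: "g \<in> carrier G" "g \<noteq> \<one>" and n: "n \<ge> 3"
    and s: "bij_betw s {1..n} (carrier G)" "s 1 = \<one>" "s n = g"
    and \<alpha>: "2 * \<alpha> * (1 - \<alpha>) = 1"
begin

text \<open>The map \<open>a \<mapsto> g - a\<close> of the block \<open>(1, 1, -2)\<close> would
  swap the neutral element and \<open>g\<close>; fixing these two instead makes \<tau> label
  preserving.\<close>

definition \<tau> :: "'a \<Rightarrow> 'a" where
  "\<tau> a = (if a = \<one> \<or> a = g then a else g \<otimes> inv a)"

definition A :: "nat \<Rightarrow> 'a \<Rightarrow> 'k" where
  "A = involution_mat \<alpha> s \<tau>"

text \<open>\<open>C\<close> is the inverse transpose of \<open>A\<close>. With \<open>A\<close>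
  acting on the first two factors and \<open>C\<close> on the third, the pairings in the blocks that
  involve the neutral element stay in diagonal form.\<close>

definition C :: "nat \<Rightarrow> 'a \<Rightarrow> 'k" where
  "C = (\<lambda>k a. A k (\<tau> a))"

lemma mult_inv_eq_iff: "a \<in> carrier G \<Longrightarrow> b \<in> carrier G \<Longrightarrow> g \<otimes> inv a = b \<longleftrightarrow> a \<otimes> b = g"
  using g by (metis inv_solve_right m_comm)

lemma \<tau>_closed: "a \<in> carrier G \<Longrightarrow> \<tau> a \<in> carrier G"
  using g by (simp add: \<tau>_def)

lemma \<tau>_\<tau>: "a \<in> carrier G \<Longrightarrow> \<tau> (\<tau> a) = a"
  using g mult_inv_eq_iff[of a \<one>] mult_inv_eq_iff[of a g] mult_inv_eq_iff[of "g \<otimes> inv a" a]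
    mult_inv_eq_iff[of a "g \<otimes> inv a"] by (auto simp: \<tau>_def m_comm)

lemma label_\<tau>: "a \<in> carrier G \<Longrightarrow> label \<one> g (\<tau> a) = label \<one> g a \<and> label g \<one> (\<tau> a) = label g \<one> a"
  using g mult_inv_eq_iff[of a \<one>] mult_inv_eq_iff[of a g] by (auto simp: \<tau>_def label_def)

lemma s_closed: "k \<in> {1..n} \<Longrightarrow> s k \<in> carrier G"
  using bij_betwE[OF s(1)] by blast

lemma s_eq_iff: "k \<in> {1..n} \<Longrightarrow> l \<in> {1..n} \<Longrightarrow> s k = s l \<longleftrightarrow> k = l"
  by (rule inj_on_eq_iff[OF bij_betw_imp_inj_on[OF s(1)]])

lemma label_s:
  assumes "k \<in> {1..n}"
  shows "label \<one> g (s k) = label 1 n k" "label g \<one> (s k) = label n 1 k"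
  using s_eq_iff[OF assms, of 1] s_eq_iff[OF assms, of n] n s(2,3) by (auto simp: label_def)

lemma A_nonzero: "A k a \<noteq> 0 \<Longrightarrow> a = s k \<or> a = \<tau> (s k)"
  by (auto simp: A_def involution_mat_def split: if_splits)

lemma A_nonzero_label:
  assumes "k \<in> {1..n}" "A k a \<noteq> 0"
  shows "label \<one> g a = label 1 n k" "label g \<one> a = label n 1 k"
  using A_nonzero[OF assms(2)] label_s[OF assms(1)] label_\<tau>[OF s_closed[OF assms(1)]] by auto

lemma label_preserving_A:
  "label_preserving (carrier G) {1..n} (label \<one> g) (label 1 n) A"
  "label_preserving (carrier G) {1..n} (label g \<one>) (label n 1) A"
  unfolding label_preserving_def using A_nonzero_label by blast+

lemma label_preserving_C:
  "label_preserving (carrier G) {1..n} (label \<one> g) (label 1 n) C"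
  "label_preserving (carrier G) {1..n} (label g \<one>) (label n 1) C"
  unfolding label_preserving_def C_def using A_nonzero_label label_\<tau> by metis+

lemma inverse_mats_A_C:
  "inverse_mats (carrier G) {1..n} A (\<lambda>a k. C k a)"
  "inverse_mats (carrier G) {1..n} C (\<lambda>a k. A k a)"
  using inverse_mats_involution_mat[OF \<alpha> fin s(1) \<tau>_closed \<tau>_\<tau>] by (simp_all add: A_def C_def)

lemma sum_A_C:
  assumes "k \<in> {1..n}" "l \<in> {1..n}"
  shows "(\<Sum>a\<in>carrier G. A k a * C l a) = (if k = l then 1 else 0)"
  using inverse_mats_A_C(1) assms by (simp add: inverse_mats_def)

lemma A_1: "k = 1 \<Longrightarrow> A k a = (if a = \<one> then 1 else 0)"
  using s(2) by (simp add: A_def involution_mat_def \<tau>_def)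

lemma C_n: "a \<in> carrier G \<Longrightarrow> C n a = (if a = g then 1 else 0)"
  using g \<tau>_\<tau>[of a] by (auto simp: C_def A_def involution_mat_def s \<tau>_def)

lemma A_middle:
  assumes "k \<in> {1..n}" "k \<noteq> 1" "k \<noteq> n" "a = \<one> \<or> a = g"
  shows "A k a = 0"
proof (rule ccontr)
  assume "A k a \<noteq> 0"
  have "a \<in> carrier G" using assms(4) g by auto
  have "label \<one> g a = label 1 n k"
    using label_preserving_A(1) \<open>a \<in> carrier G\<close> \<open>A k a \<noteq> 0\<close> assms(1) by (simp add: label_preserving_def)
  then show False using assms g by (auto simp: label_def split: if_splits)
qed

text \<open>With \<open>k = 1\<close> or \<open>l = 1\<close>, one factor is the neutral element and
  what remains is \<open>A\<close> times the transpose of \<open>C\<close>, the identity. In the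
  block \<open>(1, 1, -2)\<close> the form \<tau> is turned by \<open>A\<close> on both sides into
  the same product.\<close>

lemma transformed_coord:
  assumes klm: "k \<in> {1..n}" "l \<in> {1..n}" "m \<in> {1..n}"
    and le: "label 1 n k + label 1 n l + label n 1 m \<le> 0"
  shows "(\<Sum>a\<in>carrier G. \<Sum>b\<in>carrier G. \<Sum>c\<in>carrier G.
      coord (group_tensor G) a b c * (A k a * A l b * C m c)) = coord (CW_tensor n) k l m"
    (is "?D = _")
proof -
  have "?D = (\<Sum>a\<in>carrier G. \<Sum>b\<in>carrier G. \<Sum>c\<in>carrier G.
      if c = a \<otimes> b then A k a * A l b * C m c else 0)"
    by (intro sum.cong) (auto simp: group_tensor_coord[OF fin])
  also have "\<dots> = (\<Sum>a\<in>carrier G. \<Sum>b\<in>carrier G. A k a * A l b * C m (a \<otimes> b))"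
    using fin by (simp add: sum.delta)
  finally have D: "?D = (\<Sum>a\<in>carrier G. \<Sum>b\<in>carrier G. A k a * A l b * C m (a \<otimes> b))" .
  \<comment> \<open>If neither \<open>k\<close> nor \<open>l\<close> is 1, their labels are at least
    1, so a sum of at most 0 needs both equal to 1 and the third label -2.\<close>
  consider "k = 1" | "k \<noteq> 1" "l = 1" | "k \<noteq> 1" "k \<noteq> n" "l \<noteq> 1" "l \<noteq> n" "m = n"
    using le by (auto simp: label_def split: if_splits)
  then show ?thesis
  proof cases
    case 1
    have "?D = (\<Sum>a\<in>carrier G. if a = \<one> then \<Sum>b\<in>carrier G. A l b * C m b else 0)"
      unfolding D by (intro sum.cong) (auto simp: A_1[OF 1] intro!: sum.cong)
    also have "\<dots> = (\<Sum>b\<in>carrier G. A l b * C m b)" using fin by (simp add: sum.delta)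
    finally show ?thesis using klm 1 by (simp add: sum_A_C CW_tensor_coord)
  next
    case 2
    have "?D = (\<Sum>a\<in>carrier G. \<Sum>b\<in>carrier G. if b = \<one> then A k a * C m a else 0)"
      unfolding D by (intro sum.cong) (auto simp: A_1[OF 2(2)])
    also have "\<dots> = (\<Sum>a\<in>carrier G. A k a * C m a)" using fin by (simp add: sum.delta)
    finally show ?thesis using klm 2 by (auto simp: sum_A_C CW_tensor_coord)
  next
    case 3
    have "?D = (\<Sum>a\<in>carrier G. \<Sum>b\<in>carrier G. if g \<otimes> inv a = b then A k a * A l b else 0)"
      unfolding D by (intro sum.cong refl) (simp add: C_n 3(5) mult_inv_eq_iff)
    also have "\<dots> = (\<Sum>a\<in>carrier G. A k a * A l (g \<otimes> inv a))"
      using fin g by (simp add: sum.delta')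
    \<comment> \<open>\<open>A k\<close> vanishes at the neutral element and at \<open>g\<close>,
      the only places where \<tau> differs from \<open>a \<mapsto> g - a\<close>.\<close>
    also have "\<dots> = (\<Sum>a\<in>carrier G. A k a * C l a)"
      using A_middle[OF klm(1)] 3 by (intro sum.cong) (auto simp: C_def \<tau>_def)
    finally show ?thesis using klm 3 by (auto simp: sum_A_C CW_tensor_coord)
  qed
qed


lemma prod_transformed_coord:
  fixes P :: "(int \<times> int \<times> int) pmf"
  assumes P: "finite (set_pmf P)" "\<And>a b c. (a, b, c) \<in> set_pmf P \<Longrightarrow> a + b + c = 0"
    and w: "ks \<in> typed_words {1..n} (label 1 n) N (marginal1 P)"
      "ls \<in> typed_words {1..n} (label 1 n) N (marginal2 P)"
      "ms \<in> typed_words {1..n} (label n 1) N (marginal3 P)"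
  shows "(\<Prod>i<N. \<Sum>a\<in>carrier G. \<Sum>b\<in>carrier G. \<Sum>c\<in>carrier G.
      coord (group_tensor G) a b c * (A (ks ! i) a * A (ls ! i) b * C (ms ! i) c)) =
    (\<Prod>i<N. coord (CW_tensor n) (ks ! i) (ls ! i) (ms ! i))"
proof (rule prod_eq_if_sum_eq_0[OF sum_labels_eq_0[OF P w]])
  fix i assume "i < N"
  note klm = typed_words_nth[OF w(1) this] typed_words_nth[OF w(2) this] typed_words_nth[OF w(3) this]
  let ?w = "label 1 n (ks ! i) + label 1 n (ls ! i) + label n 1 (ms ! i)"
  show "(\<Sum>a\<in>carrier G. \<Sum>b\<in>carrier G. \<Sum>c\<in>carrier G.
      coord (group_tensor G) a b c * (A (ks ! i) a * A (ls ! i) b * C (ms ! i) c)) =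
    coord (CW_tensor n) (ks ! i) (ls ! i) (ms ! i)" if "?w \<le> 0"
    using transformed_coord[OF klm that] .
  \<comment> \<open>All blocks in the support of \<open>CW_n\<close> have label sum 0.\<close>
  show "coord (CW_tensor n) (ks ! i) (ls ! i) (ms ! i) = (0 :: 'k)" if "?w < 0"
  proof (rule ccontr)
    assume "coord (CW_tensor n) (ks ! i) (ls ! i) (ms ! i) \<noteq> (0 :: 'k)"
    then have "(label 1 n (ks ! i), label 1 n (ls ! i), label n 1 (ms ! i)) \<in>
        support_blocks 1 n (CW_tensor n :: (nat, 'k) tensor)"
      unfolding support_blocks_def using klm by auto
    then show False
      unfolding support_blocks_CW_tensor[OF n] using that by auto
  qed
qed

lemma inverse_mats_words:
  "inverse_mats (typed_words (carrier G) (label \<one> g) N p) (typed_words {1..n} (label 1 n) N p)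
    (word_mat N A) (word_mat N (\<lambda>a k. C k a))"
  "inverse_mats (typed_words (carrier G) (label g \<one>) N p) (typed_words {1..n} (label n 1) N p)
    (word_mat N C) (word_mat N (\<lambda>a k. A k a))"
  using label_preserving_A(1) label_preserving_C(1)[THEN label_preserving_transpose]
    label_preserving_C(2) label_preserving_A(2)[THEN label_preserving_transpose] inverse_mats_A_C
  by (simp_all add: inverse_mats_word_mat fin)

lemma sweet_piece_iso:
  fixes P :: "(int \<times> int \<times> int) pmf"
  assumes "finite (set_pmf P)" "\<And>a b c. (a, b, c) \<in> set_pmf P \<Longrightarrow> a + b + c = 0"
  shows "tensor_iso (sweet_piece \<one> g P N (group_tensor G :: ('a, 'k) tensor))
    (sweet_piece 1 n P N (CW_tensor n :: (nat, 'k) tensor))"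
proof (rule tensor_iso_matI[where A = "word_mat N A" and B = "word_mat N A" and C = "word_mat N C" and
      A' = "word_mat N (\<lambda>a k. C k a)" and B' = "word_mat N (\<lambda>a k. C k a)" and
      C' = "word_mat N (\<lambda>a k. A k a)"],
    unfold sweet_piece_idx sweet_piece_coord group_tensor_idx CW_tensor_idx)
  show "inverse_mats (typed_words (carrier G) (label \<one> g) N (marginal1 P))
      (typed_words {1..n} (label 1 n) N (marginal1 P)) (word_mat N A) (word_mat N (\<lambda>a k. C k a))"
    by (rule inverse_mats_words)
  show "inverse_mats (typed_words (carrier G) (label \<one> g) N (marginal2 P))
      (typed_words {1..n} (label 1 n) N (marginal2 P)) (word_mat N A) (word_mat N (\<lambda>a k. C k a))"
    by (rule inverse_mats_words)
  show "inverse_mats (typed_words (carrier G) (label g \<one>) N (marginal3 P))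
      (typed_words {1..n} (label n 1) N (marginal3 P)) (word_mat N C) (word_mat N (\<lambda>a k. A k a))"
    by (rule inverse_mats_words)
next
  fix ks ls ms
  assume w: "ks \<in> typed_words {1..n} (label 1 n) N (marginal1 P)"
    "ls \<in> typed_words {1..n} (label 1 n) N (marginal2 P)"
    "ms \<in> typed_words {1..n} (label n 1) N (marginal3 P)"
  show "(\<Sum>xs\<in>typed_words (carrier G) (label \<one> g) N (marginal1 P).
      \<Sum>ys\<in>typed_words (carrier G) (label \<one> g) N (marginal2 P).
      \<Sum>zs\<in>typed_words (carrier G) (label g \<one>) N (marginal3 P).
        (\<Prod>i<N. coord (group_tensor G) (xs ! i) (ys ! i) (zs ! i)) *
        (word_mat N A ks xs * word_mat N A ls ys * word_mat N C ms zs)) =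
    (\<Prod>i<N. coord (CW_tensor n) (ks ! i) (ls ! i) (ms ! i))"
    unfolding tensor_map_words[OF fin fin fin label_preserving_A(1) label_preserving_A(1)
      label_preserving_C(2) w]
    by (rule prod_transformed_coord[OF assms w])
qed (use fin in \<open>auto intro: finite_typed_words\<close>)

text \<open>Orthogonality of characters writes \<open>T_G\<close> as \<open>n\<close> pure tensors,
  and the matrices \<open>A\<close>, \<open>A\<close>, \<open>C\<close> keep them pure. The product
  of these position tensors has the coordinates of the sweet piece by
  \<open>prod_transformed_coord\<close>.\<close>

lemma tensor_rank_sweet_piece:
  fixes P :: "(int \<times> int \<times> int) pmf" and \<theta> :: "nat \<Rightarrow> 'a \<Rightarrow> 'k"
  assumes P: "finite (set_pmf P)" "\<And>a b c. (a, b, c) \<in> set_pmf P \<Longrightarrow> a + b + c = 0"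
    and \<theta>: "complete_characters G (carrier G) \<theta>" and "(of_nat n :: 'k) \<noteq> 0" "card (carrier G) = n"
  shows "tensor_rank (sweet_piece 1 n P N (CW_tensor n :: (nat, 'k) tensor)) \<le> n ^ N"
proof -
  have \<theta>_mult: "\<theta> s (a \<otimes> b) = \<theta> s a * \<theta> s b"
    if "s < n" "a \<in> carrier G" "b \<in> carrier G" for s a b
    using \<theta> \<open>card (carrier G) = n\<close> that by (simp add: complete_characters_def)
  have \<theta>_sum: "(\<Sum>s<n. \<theta> s h) = (if h = \<one> then of_nat n else 0)" if "h \<in> carrier G" for h
    using \<theta> \<open>card (carrier G) = n\<close> that by (simp add: complete_characters_def)
  define u where "u s k = (\<Sum>a\<in>carrier G. \<theta> s a * A k a)" for s k
  define w where "w s k = (\<Sum>c\<in>carrier G. \<theta> s (inv c) * C k c / of_nat n)" for s k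
  \<comment> \<open>Column orthogonality at \<open>a + b - c\<close> detects
    \<open>a + b = c\<close>.\<close>
  have T: "coord (group_tensor G) a b c = (\<Sum>s<n. \<theta> s a * \<theta> s b * \<theta> s (inv c) / of_nat n)"
    if "a \<in> carrier G" "b \<in> carrier G" "c \<in> carrier G" for a b c
  proof -
    have "(\<Sum>s<n. \<theta> s a * \<theta> s b * \<theta> s (inv c) / of_nat n) =
        (\<Sum>s<n. \<theta> s (a \<otimes> b \<otimes> inv c)) / of_nat n"
      using that by (simp add: \<theta>_mult sum_divide_distrib)
    also have "\<dots> = (if a \<otimes> b \<otimes> inv c = \<one> then 1 else 0)"
      using that \<theta>_sum[of "a \<otimes> b \<otimes> inv c"] \<open>(of_nat n :: 'k) \<noteq> 0\<close> by simp
    also have "a \<otimes> b \<otimes> inv c = \<one> \<longleftrightarrow> a \<otimes> b = c"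
      using that inv_solve_right[of \<one> "a \<otimes> b" c] by auto
    finally show ?thesis using that by (simp add: group_tensor_coord[OF fin])
  qed
  have rank: "(\<Sum>a\<in>carrier G. \<Sum>b\<in>carrier G. \<Sum>c\<in>carrier G.
      coord (group_tensor G) a b c * (A k a * A l b * C m c)) =
    (\<Sum>s<n. pure_tensor (u s) (u s) (w s) k l m)" for k l m
  proof -
    have "(\<Sum>s<n. pure_tensor (u s) (u s) (w s) k l m) =
        (\<Sum>s<n. \<Sum>a\<in>carrier G. \<Sum>b\<in>carrier G. \<Sum>c\<in>carrier G.
          \<theta> s a * A k a * (\<theta> s b * A l b) * (\<theta> s (inv c) * C m c / of_nat n))"
      unfolding pure_tensor_def u_def w_def by (simp only: sum_product3)
    also have "\<dots> = (\<Sum>a\<in>carrier G. \<Sum>b\<in>carrier G. \<Sum>c\<in>carrier G. \<Sum>s<n.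
          \<theta> s a * A k a * (\<theta> s b * A l b) * (\<theta> s (inv c) * C m c / of_nat n))"
      by (simp only: sum.swap[of _ _ "{..<n}"])
    also have "\<dots> = (\<Sum>a\<in>carrier G. \<Sum>b\<in>carrier G. \<Sum>c\<in>carrier G.
        coord (group_tensor G) a b c * (A k a * A l b * C m c))"
      by (intro sum.cong refl) (simp add: T sum_distrib_right, simp add: mult_ac)
    finally show ?thesis by simp
  qed
  show ?thesis
  proof (rule tensor_rank_prod_le, unfold sweet_piece_idx sweet_piece_coord CW_tensor_idx)
    fix ks ls ms
    assume words: "ks \<in> typed_words {1..n} (label 1 n) N (marginal1 P)"
      "ls \<in> typed_words {1..n} (label 1 n) N (marginal2 P)"
      "ms \<in> typed_words {1..n} (label n 1) N (marginal3 P)"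
    show "(\<Prod>i<N. coord (CW_tensor n) (ks ! i) (ls ! i) (ms ! i)) =
        (\<Prod>i<N. \<Sum>s<n. pure_tensor (u s) (u s) (w s) (ks ! i) (ls ! i) (ms ! i))"
      using prod_transformed_coord[OF P words] unfolding rank by (rule sym)
  qed
qed

end

theorem corollary6p11:
  fixes G :: "('g, 'm) monoid_scheme"
    and g :: 'g
    and n N :: nat
    and P :: "(int \<times> int \<times> int) pmf"
  assumes "comm_group G" and "finite (carrier G)" and "order G = n" and "n \<ge> 3"
    and "g \<in> carrier G" and "g \<noteq> \<one>\<^bsub>G\<^esub>"
    and "set_pmf P \<subseteq> support_blocks 1 n (CW_tensor n :: (nat, 'k::{alg_closed_field, field_char_0}) tensor)"
    and "reconstructable (support_blocks 1 n (CW_tensor n :: (nat, 'k) tensor)) P"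
    and "marginal1 P = marginal2 P" and "marginal2 P = marginal3 P"
    and "N > 0" and "\<forall>b. real N * pmf P b \<in> \<int>"
  shows "tensor_iso
           (sweet_piece \<one>\<^bsub>G\<^esub> g P N (group_tensor G :: ('g, 'k) tensor))
           (sweet_piece 1 n P N (CW_tensor n :: (nat, 'k) tensor)) \<and>
         tensor_rank (sweet_piece 1 n P N (CW_tensor n :: (nat, 'k) tensor)) \<le> n ^ N"
proof -
  interpret comm_group G by fact
  have P: "a + b + c = 0" if "(a, b, c) \<in> set_pmf P" for a b c
    using assms(7) that unfolding support_blocks_CW_tensor[OF assms(4)]
    by auto
  have finP: "finite (set_pmf P)"
    using assms(7) unfolding support_blocks_CW_tensor[OF assms(4)] by (rule finite_subset) simp
  have card: "card (carrier G) = n" using assms(3) by (simp add: Coset.order_def)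
  \<comment> \<open>A square root of -1 solves the quadratic equation for \<alpha>:
    \<open>2 * \<alpha> * (1 - \<alpha>)\<close> becomes
    \<open>(1 - \<iota>\<^sup>2) / 2 = 1\<close>.\<close>
  obtain \<iota> :: 'k where \<iota>: "\<iota>\<^sup>2 = -1" using nth_root_exists[of 2 "-1"] by auto
  define \<alpha> where "\<alpha> = (1 - \<iota>) / 2"
  have "2 * \<alpha> * (1 - \<alpha>) = (1 - \<iota>\<^sup>2) / 2"
    by (simp add: \<alpha>_def field_simps power2_eq_square)
  with \<iota> have \<alpha>: "2 * \<alpha> * (1 - \<alpha>) = 1" by simp
  obtain s where s: "bij_betw s {1..n} (carrier G)" "s 1 = \<one>\<^bsub>G\<^esub>" "s n = g"
    using obtain_bij_with_endpoints[OF assms(2) card one_closed assms(5)] assms(6) by metis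
  interpret blocked_group G g n s \<alpha>
    by unfold_locales (use assms s \<alpha> in auto)
  obtain \<theta> :: "nat \<Rightarrow> 'g \<Rightarrow> 'k" where "complete_characters G (carrier G) \<theta>"
    using ex_complete_characters[OF assms(1,2)] by blast
  then show ?thesis
    using sweet_piece_iso[OF finP P] tensor_rank_sweet_piece[OF finP P] card assms(4) by simp
qed

end
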